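(* Let $A$ be an expanding integer $n\times n$ matrix, let $D\subset\mathbb{Z}^n$ be a nonempty finite subset, and let $T=T(A,D)$ be the associated self-affine set. Let $K\supset D$ be the finite set, $C\subset K$ the coset transversal for $\mathbb{Z}^n/A(\mathbb{Z}^n)$, $\mathcal{N}_D$ the finite labeled graph, $F_v\subset C^{-\omega}$ (for $v$ a vertex of $\mathcal{N}_D$) the sets, and $\mu$ the uniform Bernoulli measure on $C^{-\omega}$, all as defined in the context. Then for every $u\in\mathbb{Z}^n$, \[ \lambda\bigl(T\cap(T+u)\bigr)=\sum_{\substack{v_1,v_2\in\mathcal{N}_D\\ u=v_2-v_1}}\mu(F_{v_1}\cap F_{v_2}), \] where the sum is over all pairs $(v_1,v_2)$ of vertices of $\mathcal{N}_D$ with $v_2-v_1=u$.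
   Context: An integer matrix $A$ is expanding if every eigenvalue of $A$ has modulus greater than $1$. For a finite nonempty set $D\subset\mathbb{Z}^n$, the self-affine set $T=T(A,D)\subset\mathbb{R}^n$ is the unique nonempty compact set with $A(T)=\bigcup_{d\in D}(T+d)$; explicitly $T=\{\sum_{k=1}^\infty A^{-k}d_k : d_k\in D\}$. $\lambda$ denotes Lebesgue measure on $\mathbb{R}^n$. Choice of $K$ and $C$: if $D$ contains representatives of all cosets of $\mathbb{Z}^n/A(\mathbb{Z}^n)$, put $K=D$; otherwise let $K\subset\mathbb{Z}^n$ be any finite set with $K\supset D$ that contains representatives of all cosets. Let $C\subset K$ be any coset transversal for $\mathbb{Z}^n/A(\mathbb{Z}^n)$ (exactly one representative of each coset). The directed labeled graph $\Gamma=\Gamma(A,K)$ has vertex set $\mathbb{Z}^n$, and for $u,v\in\mathbb{Z}^n$ and $x,y\in K$ there is a directed edge from $u$ to $v$ labeled by $(x,y)$ if and only if $u+x=y+Av$. The nucleus $\mathcal{N}$ of $\Gamma$ is the subgraph spanned by all (directed) cycles of $\Gamma$ and all vertices that can be reached by following directed paths from the cycles; it is a finite graph. The graph $\mathcal{N}_D$ is obtained from $\mathcal{N}$ (keeping its vertices) by removing every edge whose label is not in $C\times D$ and replacing every remaining label $(a,b)$ by $a$. So edges of $\mathcal{N}_D$ are labeled by elements of $C$. $C^{-\omega}$ is the space of all left-infinite sequences $\ldots x_2x_1$ with $x_i\in C$, with the product topology of discrete sets; $\mu$ is the uniform Bernoulli measure on $C^{-\omega}$, i.e. the product measure with $\mu(x)=1/|C|$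 for each $x\in C$. For a vertex $v$ of $\mathcal{N}_D$, $F_v\subset C^{-\omega}$ is the set of all left-infinite sequences $\ldots x_2x_1$ that can be read along left-infinite directed paths $\cdots\xrightarrow{x_3}v_2\xrightarrow{x_2}v_1\xrightarrow{x_1}v$ in $\mathcal{N}_D$ ending in $v$. The sets $F_v$ are closed, hence measurable. *)

theory Defs
  imports "HOL-Probability.Probability"
begin

definition expanding :: "int ^ 'n ^ 'n \<Rightarrow> bool" where
  "expanding A \<longleftrightarrow>
    (\<forall>z v. v \<noteq> 0 \<and> map_matrix complex_of_int A *v v = z *s v \<longrightarrow> cmod z > 1)"

definition vec_of_int :: "int ^ 'n \<Rightarrow> real ^ 'n" where
  "vec_of_int v = (\<chi> i. real_of_int (v $ i))"

definition self_affine_set :: "int ^ 'n ^ 'n \<Rightarrow> (int ^ 'n) set \<Rightarrow> (real ^ 'n) set" where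
  "self_affine_set A D =
    (THE T. T \<noteq> {} \<and> compact T \<and>
       (\<lambda>t. map_matrix real_of_int A *v t) ` T = (\<Union>d\<in>D. (\<lambda>t. t + vec_of_int d) ` T))"

definition contains_coset_reps :: "int ^ 'n ^ 'n \<Rightarrow> (int ^ 'n) set \<Rightarrow> bool" where
  "contains_coset_reps A S \<longleftrightarrow> (\<forall>z. \<exists>s\<in>S. z - s \<in> range (\<lambda>w. A *v w))"

definition coset_transversal :: "int ^ 'n ^ 'n \<Rightarrow> (int ^ 'n) set \<Rightarrow> bool" where
  "coset_transversal A C \<longleftrightarrow> (\<forall>z. \<exists>!c. c \<in> C \<and> z - c \<in> range (\<lambda>w. A *v w))"

text \<open>A labeled directed graph is given by its edges, as triples (source, label, target).
  Parallel edges with different labels are distinct.\<close>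

type_synonym ('v, 'l) lgraph = "('v \<times> 'l \<times> 'v) set"

definition adjacent :: "('v, 'l) lgraph \<Rightarrow> ('v \<times> 'v) set" where
  "adjacent E = {(u, v). \<exists>l. (u, l, v) \<in> E}"

definition Gamma_edges ::
  "int ^ 'n ^ 'n \<Rightarrow> (int ^ 'n) set \<Rightarrow> (int ^ 'n, (int ^ 'n) \<times> (int ^ 'n)) lgraph" where
  "Gamma_edges A K = {(u, (x, y), v). x \<in> K \<and> y \<in> K \<and> u + x = y + A *v v}"

text \<open>A vertex lies on a directed cycle (loops included) iff it is related to itself by the
  transitive closure of adjacency.\<close>

definition nucleus_verts :: "('v, 'l) lgraph \<Rightarrow> 'v set" where
  "nucleus_verts E = {v. \<exists>w. (w, w) \<in> (adjacent E)\<^sup>+ \<and> (w, v) \<in> (adjacent E)\<^sup>*}"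

definition nucleus_edges :: "('v, 'l) lgraph \<Rightarrow> ('v, 'l) lgraph" where
  "nucleus_edges E = {(u, l, v) \<in> E. u \<in> nucleus_verts E \<and> v \<in> nucleus_verts E}"

definition ND_verts :: "int ^ 'n ^ 'n \<Rightarrow> (int ^ 'n) set \<Rightarrow> (int ^ 'n) set" where
  "ND_verts A K = nucleus_verts (Gamma_edges A K)"

definition ND_edges ::
  "int ^ 'n ^ 'n \<Rightarrow> (int ^ 'n) set \<Rightarrow> (int ^ 'n) set \<Rightarrow> (int ^ 'n) set
     \<Rightarrow> (int ^ 'n, int ^ 'n) lgraph" where
  "ND_edges A K C D =
    {(u, a, v). a \<in> C \<and> (\<exists>b\<in>D. (u, (a, b), v) \<in> nucleus_edges (Gamma_edges A K))}"

text \<open>A left-infinite sequence \<open>\<dots> x\<^sub>2 x\<^sub>1\<close> is represented by a function \<open>x\<close> on the natural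
  numbers with \<open>x i\<close> standing for \<open>x\<^sub>i\<^sub>+\<^sub>1\<close>; likewise \<open>p i\<close> is the vertex \<open>v\<^sub>i\<close> of a left-infinite
  path, with \<open>p 0 = v\<close> its end.\<close>

definition left_inf_readable :: "('v, 'l) lgraph \<Rightarrow> 'v \<Rightarrow> (nat \<Rightarrow> 'l) set" where
  "left_inf_readable E v = {x. \<exists>p. p 0 = v \<and> (\<forall>i. (p (Suc i), x i, p i) \<in> E)}"

definition bernoulli_measure :: "'l set \<Rightarrow> (nat \<Rightarrow> 'l) measure" where
  "bernoulli_measure C = (\<Pi>\<^sub>M i\<in>UNIV. uniform_count_measure C)"

end

theory Submission
  imports Defs "HOL-Complex_Analysis.Complex_Analysis"
begin

text \<open>
  Write \<open>B\<close> for the inverse of \<open>A\<close> over the reals and, for a sequence \<open>x\<close> of integer digits, write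
  \<open>encode x\<close> for the sum of \<open>B\<^sup>k\<^sup>+\<^sup>1 x\<^sub>k\<close> over \<open>k \<ge> 0\<close>. All eigenvalues of \<open>A\<close> exceed \<open>1\<close> in modulus,
  so the powers of \<open>B\<close> decay geometrically (\<open>expanding_inverse_decays\<close>) and these sums converge
  uniformly. In particular \<open>T\<close> is the set of all \<open>encode d\<close> with digits in \<open>D\<close>.

  An edge of the graph from \<open>u\<close> to \<open>v\<close> labeled \<open>(x, y)\<close> says \<open>v = B (u + x - y)\<close>. Reading a
  left-infinite path backwards from its end \<open>v\<close> therefore expands \<open>v\<close> as \<open>encode x - encode d\<close>, where
  \<open>x\<close> and \<open>d\<close> are the two label sequences. Conversely, such an expansion of an integer vector determines the
  path, whose vertices stay in a bounded set of integer vectors, hence repeat, hence lie in the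
  nucleus. So \<open>F\<^sub>v\<close> is exactly the set of sequences \<open>x\<close> over \<open>C\<close> with \<open>encode x - v \<in> T\<close>
  (\<open>readable_imp_mem\<close>, \<open>mem_imp_readable\<close>), and it is empty when \<open>v\<close> is not in the nucleus.

  The right-hand side of the theorem thus becomes the sum over all integer vectors \<open>v\<close> of the
  probability that \<open>encode x - v\<close> lies in \<open>T \<inter> (T + u)\<close>, with \<open>x\<close> a uniform random sequence over \<open>C\<close>.
  Let \<open>N E\<close> be the same sum with an arbitrary Borel set \<open>E\<close> in place of \<open>T \<inter> (T + u)\<close>. The theorem
  holds because the measure \<open>N\<close> is Lebesgue measure (\<open>lattice_sum_eq_lborel\<close>). By construction \<open>N\<close> is
  invariant under integer translations and gives the unit cube measure \<open>1\<close>. The law of \<open>encode x\<close>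
  is self-similar, since \<open>encode x\<close> is \<open>B\<close> applied to a uniform digit in \<open>C\<close> plus an independent copy
  of \<open>encode x\<close>. As \<open>C\<close> is a transversal, the vectors \<open>A v - c\<close> enumerate the integer lattice once,
  and summing over the lattice gives \<open>|C| N(E) = N(B\<^sup>-\<^sup>1 E)\<close> (\<open>lattice_sum_scaling\<close>). Hence, along
  with \<open>t\<close>, also \<open>B t\<close> is a period of \<open>N\<close>. The periods contain every lattice \<open>B\<^sup>k \<int>\<^sup>n\<close>, so they are
  dense, and a locally finite measure with dense periods is invariant under all translations.
  Uniqueness of translation-invariant measures (\<open>translation_invariant_eq_lborel\<close>) concludes.
\<close>

section \<open>Geometric decay of the inverse powers of an expanding matrix\<close>

\<comment> \<open>The symbol is reserved for components of vectors; coefficients of power series are written out.\<close>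
no_notation fps_nth (infixl \<open>$\<close> 75)

text \<open>By Cramer's rule the components of \<open>(A - z)\<^sup>-\<^sup>1 v\<close> are rational functions of \<open>z\<close> whose poles
  are eigenvalues of \<open>A\<close>. They are thus holomorphic on a disc of radius greater than \<open>1\<close>, and their
  Taylor coefficients decay geometrically. Comparing coefficients in \<open>(A - z) x(z) = v\<close> shows that
  the coefficient of \<open>z\<^sup>k\<close> is \<open>A\<^sup>-\<^sup>k\<^sup>-\<^sup>1 v\<close>. The rate depends only on the disc, not on \<open>v\<close>.\<close>
lemma resolvent_coefficients_decay:
  fixes A :: "complex ^ 'n ^ 'n"
  assumes ev: "\<And>z v. v \<noteq> 0 \<Longrightarrow> A *v v = z *s v \<Longrightarrow> cmod z > 1"
  obtains r where "0 < r" "r < 1"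
    "\<And>v. \<exists>X M. A *v X 0 = v \<and> (\<forall>k. A *v X (Suc k) = X k) \<and> (\<forall>k. norm (X k) \<le> M * r ^ k)"
proof -
  define P where "P z = (\<chi> i j. A $ i $ j - (if i = j then z else 0))" for z
  have P_mult: "P z *v x = A *v x - z *s x" for z x
    by (simp add: P_def vec_eq_iff matrix_vector_mult_def left_diff_distrib sum_subtractf
        if_distrib[of "\<lambda>t. t * _"] cong: if_cong)
  have det_nz: "det (P z) \<noteq> 0" if "cmod z \<le> 1" for z
  proof -
    have "inj ((*v) (P z))"
    proof (rule injI)
      fix x y assume "P z *v x = P z *v y"
      hence "A *v (x - y) = z *s (x - y)"
        by (simp add: P_mult matrix_vector_mult_diff_distrib algebra_simps vector_ssub_ldistrib)
      with ev[of "x - y" z] that show "x = y" by fastforce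
    qed
    thus ?thesis
      by (metis invertible_det_nz invertible_left_inverse matrix_left_invertible_injective)
  qed
  have P_holo: "(\<lambda>z. P z $ i $ j) holomorphic_on S" for i j S
    unfolding P_def by (cases "i = j") (auto intro!: holomorphic_intros)
  have det_holo: "(\<lambda>z. det (P z)) holomorphic_on S" for S
    unfolding det_def by (auto intro!: holomorphic_intros P_holo)
  \<comment> \<open>By compactness the eigenvalues stay away from the closed unit disc; the point \<open>2\<close> only
    ensures that the set is nonempty when there is no eigenvalue in the larger disc.\<close>
  define Z where "Z = insert 2 {z \<in> cball 0 2. det (P z) = 0}"
  have "closed {z. det (P z) = 0}"
    by (intro closed_Collect_eq continuous_intros holomorphic_on_imp_continuous_on det_holo)
  hence "compact (cball 0 2 \<inter> {z. det (P z) = 0})" by (intro compact_Int_closed) auto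
  hence "compact Z" unfolding Z_def by (intro compact_insert) (simp add: Int_def)
  then obtain z0 where z0: "z0 \<in> Z" "\<And>z. z \<in> Z \<Longrightarrow> cmod z0 \<le> cmod z"
    using distance_attains_inf[of Z 0] unfolding Z_def by (auto simp: compact_imp_closed)
  define \<rho> where "\<rho> = cmod z0"
  have "\<rho> > 1"
    using z0(1) det_nz[of z0] unfolding Z_def \<rho>_def by (cases "cmod z0 \<le> 1") auto
  have det_nz': "det (P z) \<noteq> 0" if "cmod z < \<rho>" for z
    using z0(2)[of z] z0(2)[of 2] that unfolding Z_def \<rho>_def by auto
  obtain s where s: "1 < s" "s < \<rho>" using \<open>\<rho> > 1\<close> dense by blast
  show thesis
  proof (rule that[of "inverse s"])
    show "0 < inverse s" "inverse s < 1" using s by (auto simp: field_simps)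
    fix v :: "complex ^ 'n"
    define x where
      "x z = (\<chi> k. det (\<chi> i j. if j = k then v $ i else P z $ i $ j) / det (P z))" for z
    have x_solves: "P z *v x z = v" if "cmod z < \<rho>" for z
      using cramer[OF det_nz'[OF that]] unfolding x_def by blast
    have x_holo: "(\<lambda>z. x z $ i) holomorphic_on ball 0 \<rho>" for i
    proof -
      have "(\<lambda>z. if j = i then v $ k else P z $ k $ j) holomorphic_on UNIV" for j k
        by (cases "j = i") (auto intro!: P_holo)
      hence "(\<lambda>z. det (\<chi> k j. if j = i then v $ k else P z $ k $ j)) holomorphic_on UNIV"
        unfolding det_def by (auto intro!: holomorphic_intros)
      hence "(\<lambda>z. det (\<chi> k j. if j = i then v $ k else P z $ k $ j) / det (P z))
          holomorphic_on ball 0 \<rho>"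
        by (intro holomorphic_on_divide det_holo) (auto intro: holomorphic_on_subset dest: det_nz')
      thus ?thesis unfolding x_def by simp
    qed
    define F where "F i = fps_expansion (\<lambda>z. x z $ i) 0" for i
    have F: "(\<lambda>z. x z $ i) has_fps_expansion F i" for i
      unfolding F_def
      by (rule has_fps_expansion_fps_expansion[OF open_ball _ x_holo]) (use \<open>\<rho> > 1\<close> in auto)
    have F_eq: "(\<Sum>j\<in>UNIV. fps_const (A $ i $ j) * F j) - fps_X * F i = fps_const (v $ i)" for i
    proof (rule fps_expansion_unique_complex)
      show "(\<lambda>z. (\<Sum>j\<in>UNIV. A $ i $ j * x z $ j) - z * x z $ i) has_fps_expansion
              ((\<Sum>j\<in>UNIV. fps_const (A $ i $ j) * F j) - fps_X * F i)"
        by (intro fps_expansion_intros F)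
      have near: "\<forall>\<^sub>F z in nhds 0. v $ i = (\<Sum>j\<in>UNIV. A $ i $ j * x z $ j) - z * x z $ i"
      proof (rule eventually_mono[OF eventually_nhds_in_open[of "ball 0 \<rho>"]])
        fix z :: complex assume "z \<in> ball 0 \<rho>"
        hence "(A *v x z - z *s x z) $ i = v $ i" using x_solves by (simp flip: P_mult)
        thus "v $ i = (\<Sum>j\<in>UNIV. A $ i $ j * x z $ j) - z * x z $ i"
          by (simp add: matrix_vector_mult_def)
      qed (use \<open>\<rho> > 1\<close> in auto)
      show "(\<lambda>z. (\<Sum>j\<in>UNIV. A $ i $ j * x z $ j) - z * x z $ i) has_fps_expansion fps_const (v $ i)"
        using has_fps_expansion_cong[OF near refl] by auto
    qed
    define X where "X k = (\<chi> i. fps_nth (F i) k)" for k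
    have X0: "A *v X 0 = v"
      using arg_cong[OF F_eq, of "\<lambda>G. fps_nth G 0"]
      by (simp add: vec_eq_iff matrix_vector_mult_def X_def fps_sum_nth)
    have XS: "A *v X (Suc k) = X k" for k
      using arg_cong[OF F_eq, of "\<lambda>G. fps_nth G (Suc k)"]
      by (simp add: vec_eq_iff matrix_vector_mult_def X_def fps_sum_nth)
    have "\<exists>M. \<forall>k. cmod (X k $ i) \<le> M * inverse s ^ k" for i
    proof -
      have "fps_conv_radius (F i) \<ge> ereal \<rho>"
        unfolding F_def by (intro conv_radius_fps_expansion) (use x_holo in auto)
      hence "ereal (cmod (of_real s)) < fps_conv_radius (F i)"
        by (rule less_le_trans[rotated]) (use s in simp)
      hence "summable (\<lambda>k. fps_nth (F i) k * of_real s ^ k)" by (rule summable_fps)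
      hence "Bseq (\<lambda>k. fps_nth (F i) k * of_real s ^ k)"
        by (rule convergent_imp_Bseq[OF convergentI[OF summable_LIMSEQ_zero]])
      then obtain M where "\<And>k. cmod (fps_nth (F i) k * of_real s ^ k) \<le> M"
        unfolding Bseq_def by blast
      hence "\<forall>k. cmod (X k $ i) \<le> M * inverse s ^ k"
        using s by (simp add: X_def norm_mult norm_power field_simps)
      thus ?thesis ..
    qed
    then obtain M where M: "\<And>i k. cmod (X k $ i) \<le> M i * inverse s ^ k" by metis
    have "norm (X k) \<le> (\<Sum>i\<in>UNIV. M i) * inverse s ^ k" for k
    proof -
      have "norm (X k) \<le> (\<Sum>i\<in>UNIV. cmod (X k $ i))"
        unfolding norm_vec_def by (rule L2_set_le_sum) simp
      also have "\<dots> \<le> (\<Sum>i\<in>UNIV. M i * inverse s ^ k)" by (intro sum_mono M)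
      finally show ?thesis by (simp only: sum_distrib_right)
    qed
    with X0 XS show "\<exists>X M. A *v X 0 = v \<and> (\<forall>k. A *v X (Suc k) = X k) \<and>
        (\<forall>k. norm (X k) \<le> M * inverse s ^ k)" by blast
  qed
qed

text \<open>The eigenvalue condition lives over the complex numbers, so decay is proved for the
  complexified orbit of each vector and then made uniform by summing over a basis.\<close>
lemma expanding_inverse_decays:
  fixes A :: "int ^ 'n ^ 'n"
  assumes "expanding A"
  obtains B :: "real ^ 'n \<Rightarrow> real ^ 'n" and M r where "linear B"
    "\<And>x. map_matrix real_of_int A *v B x = x" "\<And>x. B (map_matrix real_of_int A *v x) = x"
    "0 < r" "r < 1" "\<And>k x. norm ((B ^^ k) x) \<le> M * r ^ k * norm x"
proof -
  define R where "R = map_matrix real_of_int A"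
  define Z where "Z = map_matrix complex_of_int A"
  define cplx :: "real ^ 'n \<Rightarrow> complex ^ 'n" where "cplx x = (\<chi> i. of_real (x $ i))" for x
  have ev: "cmod z > 1" if "v \<noteq> 0" "Z *v v = z *s v" for z v
    using assms that unfolding expanding_def Z_def by blast
  have cplx_mult: "cplx (R *v x) = Z *v cplx x" for x
    by (simp add: cplx_def R_def Z_def vec_eq_iff matrix_vector_mult_def)
  have cplx_norm: "norm (cplx x) = norm x" for x
    by (simp add: cplx_def norm_vec_def)
  have cplx_inj: "cplx x = cplx y \<longleftrightarrow> x = y" for x y
    by (simp add: cplx_def vec_eq_iff)
  have Z_inj: "x = y" if "Z *v x = Z *v y" for x y
  proof -
    have "Z *v (x - y) = 0 *s (x - y)"
      using that by (simp add: matrix_vector_mult_diff_distrib)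
    with ev[of "x - y" 0] show ?thesis by fastforce
  qed
  have "inj ((*v) R)"
    using Z_inj cplx_mult cplx_inj by (metis injI)
  then obtain B' where B': "B' ** R = mat 1" "R ** B' = mat 1"
    by (metis matrix_left_invertible_injective matrix_left_right_inverse)
  define B where "B x = B' *v x" for x
  have RB: "R *v B x = x" and BR: "B (R *v x) = x" for x
    using B' by (simp_all add: B_def matrix_vector_mul_assoc)
  have "linear B" unfolding B_def by simp
  obtain r where r: "0 < r" "r < 1" and
    dec: "\<And>v. \<exists>X M. Z *v X 0 = v \<and> (\<forall>k. Z *v X (Suc k) = X k) \<and> (\<forall>k. norm (X k) \<le> M * r ^ k)"
    by (rule resolvent_coefficients_decay[of Z]) (use ev in auto)
  have "\<exists>M. \<forall>k. norm ((B ^^ k) x) \<le> M * r ^ k" for x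
  proof -
    obtain X M where X: "Z *v X 0 = cplx (R *v x)" "\<And>k. Z *v X (Suc k) = X k"
      and M: "\<And>k. norm (X k) \<le> M * r ^ k"
      using dec by metis
    have "X k = cplx ((B ^^ k) x)" for k
    proof (induction k)
      case 0
      show ?case using X(1) by (auto simp: cplx_mult intro: Z_inj)
    next
      case (Suc k)
      have "Z *v cplx ((B ^^ Suc k) x) = Z *v X (Suc k)"
        by (simp add: cplx_mult[symmetric] RB X(2) Suc)
      thus ?case using Z_inj by metis
    qed
    with M show ?thesis by (metis cplx_norm)
  qed
  then obtain M where M: "\<And>x k. norm ((B ^^ k) x) \<le> M x * r ^ k" by metis
  have "norm ((B ^^ k) x) \<le> (\<Sum>b\<in>Basis. M b) * r ^ k * norm x" for k x
  proof -
    have lin: "linear (B ^^ k)"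
      using \<open>linear B\<close> by (induction k) (auto simp: linear_iff)
    have "(B ^^ k) x = (B ^^ k) (\<Sum>b\<in>Basis. (x \<bullet> b) *\<^sub>R b)"
      by (simp add: euclidean_representation)
    also have "\<dots> = (\<Sum>b\<in>Basis. (x \<bullet> b) *\<^sub>R (B ^^ k) b)"
      using lin by (simp add: linear_sum linear_scale)
    also have "norm \<dots> \<le> (\<Sum>b\<in>Basis. norm x * (M b * r ^ k))"
      by (rule sum_norm_le) (auto intro!: mult_mono M Basis_le_norm)
    also have "\<dots> = (\<Sum>b\<in>Basis. M b) * r ^ k * norm x"
      by (simp add: sum_distrib_right sum_distrib_left mult_ac)
    finally show ?thesis .
  qed
  with that[OF \<open>linear B\<close> RB[unfolded R_def] BR[unfolded R_def] r] show thesis .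
qed

section \<open>Expansions in powers of an eventually contracting linear map\<close>

text \<open>The map need not shrink any given norm in a single step; only its iterates are controlled.\<close>
locale iterated_contraction =
  fixes B :: "'a::euclidean_space \<Rightarrow> 'a" and M r :: real
  assumes lin: "linear B" and r: "0 < r" "r < 1"
    and decay: "norm ((B ^^ k) x) \<le> M * r ^ k * norm x"
begin

lemma linear_iterate: "linear (B ^^ k)"
  using lin by (induction k) (auto simp: linear_iff)

lemma M_nonneg: "M \<ge> 0"
proof -
  obtain b :: 'a where "b \<in> Basis" using nonempty_Basis by blast
  thus ?thesis using decay[of 0 b] by simp
qed

lemma iterate_LIMSEQ_zero:
  assumes "bounded (range p)"
  shows "(\<lambda>k. (B ^^ k) (p k)) \<longlonglongrightarrow> 0"
proof -
  obtain E where E: "\<And>k. norm (p k) \<le> E"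
    using assms unfolding bounded_iff by auto
  have "norm ((B ^^ k) (p k)) \<le> M * r ^ k * E" for k
    by (rule order_trans[OF decay mult_left_mono[OF E]]) (use r M_nonneg in auto)
  moreover have "(\<lambda>k. M * r ^ k * E) \<longlonglongrightarrow> 0"
    using r by (intro tendsto_mult_left_zero tendsto_mult_right_zero LIMSEQ_power_zero) auto
  ultimately show ?thesis by (rule Lim_null_comparison[OF always_eventually[OF allI]])
qed

text \<open>The exponents start at \<open>1\<close>: the first digit already sits behind the point.\<close>
definition expand :: "(nat \<Rightarrow> 'a) \<Rightarrow> 'a" where
  "expand e = (\<Sum>k. (B ^^ Suc k) (e k))"

lemma expand_norm_bounds:
  assumes "\<And>k. norm (e k) \<le> E"
  shows "norm ((B ^^ Suc k) (e k)) \<le> M * E * r ^ k"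
proof -
  have "norm ((B ^^ Suc k) (e k)) \<le> M * r ^ Suc k * norm (e k)" by (rule decay)
  also have "\<dots> \<le> M * r ^ k * E"
    using r M_nonneg assms[of k] mult_left_le_one_le[of "r ^ k" r]
    by (intro mult_mono) auto
  finally show ?thesis by (simp add: mult_ac)
qed

lemma geometric_majorant: "summable (\<lambda>k. M * E * r ^ k)"
  using r by (intro summable_mult summable_geometric) auto

lemma expand_summable:
  assumes "bounded (range e)"
  shows "summable (\<lambda>k. (B ^^ Suc k) (e k))"
proof -
  obtain E where "\<And>k. norm (e k) \<le> E"
    using assms unfolding bounded_iff by auto
  from expand_norm_bounds[OF this] geometric_majorant show ?thesis
    by (rule summable_comparison_test'[rotated])
qed

lemma expand_le:
  assumes "\<And>k. norm (e k) \<le> E"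
  shows "norm (expand e) \<le> M * E / (1 - r)"
proof -
  have "norm (expand e) \<le> (\<Sum>k. M * E * r ^ k)"
    unfolding expand_def by (intro norm_suminf_le expand_norm_bounds assms geometric_majorant)
  also have "\<dots> = M * E / (1 - r)"
    using r by (simp add: suminf_mult suminf_geometric)
  finally show ?thesis .
qed

lemma expand_diff:
  assumes "bounded (range e)" "bounded (range f)"
  shows "expand (\<lambda>k. e k - f k) = expand e - expand f"
  unfolding expand_def
  by (simp only: linear_diff[OF linear_iterate] suminf_diff[OF assms[THEN expand_summable]])

lemma expand_unroll:
  assumes "\<And>i. p i = B (p (Suc i) + e i)"
  shows "p 0 = (\<Sum>k<m. (B ^^ Suc k) (e k)) + (B ^^ m) (p m)"
proof (induction m)
  case (Suc m)
  have "(B ^^ m) (p m) = (B ^^ m) (B (p (Suc m) + e m))"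
    using assms[of m] by simp
  also have "\<dots> = (B ^^ Suc m) (p (Suc m)) + (B ^^ Suc m) (e m)"
    using linear_add[OF linear_iterate[of "Suc m"]] by (simp only: funpow_Suc_right o_def)
  finally show ?case using Suc by (simp only: sum.lessThan_Suc add_ac)
qed simp

lemma expand_partial_sums_converge:
  assumes "bounded (range e)" "bounded (range p)"
  shows "(\<lambda>m. (\<Sum>k<m. (B ^^ Suc k) (e k)) + (B ^^ m) (p m)) \<longlonglongrightarrow> expand e"
proof -
  have "(\<lambda>m. (\<Sum>k<m. (B ^^ Suc k) (e k)) + (B ^^ m) (p m)) \<longlonglongrightarrow> expand e + 0"
    unfolding expand_def
    by (intro tendsto_add summable_LIMSEQ expand_summable iterate_LIMSEQ_zero assms)
  thus ?thesis by simp
qed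

text \<open>A bounded orbit that absorbs one digit per step is determined by its digits, because the
  remainder \<open>B\<^sup>m (p m)\<close> of the finite expansion vanishes in the limit. This is what turns a
  left-infinite path in the graph into an identity between points.\<close>
lemma expand_eqI:
  assumes "\<And>i. p i = B (p (Suc i) + e i)" "bounded (range p)" "bounded (range e)"
  shows "p 0 = expand e"
proof (rule LIMSEQ_unique)
  show "(\<lambda>m. (\<Sum>k<m. (B ^^ Suc k) (e k)) + (B ^^ m) (p m)) \<longlonglongrightarrow> p 0"
    using expand_unroll[of p e, OF assms(1)] by (simp del: funpow.simps)
  show "(\<lambda>m. (\<Sum>k<m. (B ^^ Suc k) (e k)) + (B ^^ m) (p m)) \<longlonglongrightarrow> expand e"
    by (rule expand_partial_sums_converge[OF assms(3,2)])
qed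

lemma expand_shift:
  assumes "bounded (range e)"
  shows "expand e = B (e 0 + expand (\<lambda>k. e (Suc k)))"
proof -
  have bdd: "bounded (range (\<lambda>k. e (Suc k)))"
    by (rule bounded_subset[OF assms]) auto
  have "expand e = B (e 0) + (\<Sum>k. (B ^^ Suc (Suc k)) (e (Suc k)))"
    unfolding expand_def using suminf_split_head[OF expand_summable[OF assms]] by simp
  also have "(\<Sum>k. (B ^^ Suc (Suc k)) (e (Suc k))) = B (expand (\<lambda>k. e (Suc k)))"
    unfolding expand_def
    using bounded_linear.suminf[OF linear_conv_bounded_linear[THEN iffD1, OF lin]
        expand_summable[OF bdd]] by simp
  finally show ?thesis by (simp add: linear_add[OF lin])
qed

definition attractor :: "'a set \<Rightarrow> 'a set" where
  "attractor E = expand ` {e. range e \<subseteq> E}"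

text \<open>The sequences over \<open>E\<close> form a compact space by Tychonoff's theorem, and \<open>expand\<close> is continuous
  on it as a uniform limit of functions of finitely many digits.\<close>
lemma attractor_compact:
  assumes "compact E"
  shows "compact (attractor E)"
proof -
  let ?S = "{e::nat \<Rightarrow> 'a. range e \<subseteq> E}"
  have S: "?S = PiE UNIV (\<lambda>_. E)" by auto
  have "compactin (product_topology (\<lambda>_::nat. euclidean) UNIV) (PiE UNIV (\<lambda>_. E))"
    using assms by (simp add: compactin_PiE)
  hence "compact ?S" unfolding S by (simp add: euclidean_product_topology)
  obtain b where b: "\<And>x. x \<in> E \<Longrightarrow> norm x \<le> b"
    using compact_imp_bounded[OF assms] unfolding bounded_iff by blast
  have coord: "continuous_on ?S (\<lambda>e. (B ^^ Suc k) (e k))" for k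
    by (rule continuous_on_compose2[OF linear_continuous_on[OF
          linear_conv_bounded_linear[THEN iffD1, OF linear_iterate]]
          continuous_on_subset[OF continuous_on_product_coordinates]]) auto
  have "uniform_limit ?S (\<lambda>m e. \<Sum>k<m. (B ^^ Suc k) (e k)) (\<lambda>e. \<Sum>k. (B ^^ Suc k) (e k))
      sequentially"
    by (rule Weierstrass_m_test[OF _ geometric_majorant[of b]])
       (auto intro!: expand_norm_bounds b simp del: funpow.simps)
  hence "continuous_on ?S expand"
    unfolding expand_def
    by (rule uniform_limit_theorem[rotated])
       (auto intro!: always_eventually continuous_on_sum coord simp del: funpow.simps)
  with \<open>compact ?S\<close> show ?thesis
    unfolding attractor_def by (rule compact_continuous_image[rotated])
qed

lemma bounded_digits:
  assumes "compact E" "range e \<subseteq> E"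
  shows "bounded (range e)"
  using assms compact_imp_bounded bounded_subset by blast

lemma attractor_eq:
  assumes "compact E"
  shows "attractor E = {B (t + d) | t d. t \<in> attractor E \<and> d \<in> E}"
proof (intro equalityI subsetI)
  fix t assume "t \<in> attractor E"
  then obtain e where e: "t = expand e" "range e \<subseteq> E" unfolding attractor_def by auto
  have "t = B (expand (\<lambda>k. e (Suc k)) + e 0)"
    using expand_shift[OF bounded_digits[OF assms e(2)]] e(1) by (simp add: add.commute)
  thus "t \<in> {B (t + d) | t d. t \<in> attractor E \<and> d \<in> E}"
    using e(2) unfolding attractor_def by blast
next
  fix s assume "s \<in> {B (t + d) | t d. t \<in> attractor E \<and> d \<in> E}"
  then obtain e d where e: "s = B (expand e + d)" "range e \<subseteq> E" "d \<in> E"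
    unfolding attractor_def by auto
  let ?e = "case_nat d e"
  have rng: "range ?e \<subseteq> E" using e by (auto simp: image_subset_iff split: nat.splits)
  have "expand ?e = s"
    using expand_shift[OF bounded_digits[OF assms rng]] e(1) by (simp add: add.commute)
  thus "s \<in> attractor E" unfolding attractor_def using rng by blast
qed

text \<open>Iterating the set equation expands each point of \<open>T\<close> in digits from \<open>E\<close>. Conversely the
  truncated expansions, with any point of \<open>T\<close> as remainder, stay in \<open>T\<close>, which is closed.\<close>
lemma attractor_unique:
  assumes E: "compact E" and T: "T \<noteq> {}" "compact T"
    and T_eq: "T = {B (t + d) | t d. t \<in> T \<and> d \<in> E}"
  shows "T = attractor E"
proof (intro equalityI subsetI)
  fix t assume "t \<in> T"
  have "\<exists>t' d. t' \<in> T \<and> d \<in> E \<and> s = B (t' + d)" if "s \<in> T" for s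
    using that T_eq by blast
  then obtain f g where fg: "\<And>s. s \<in> T \<Longrightarrow> f s \<in> T \<and> g s \<in> E \<and> s = B (f s + g s)" by metis
  hence g: "\<And>s. s \<in> T \<Longrightarrow> g s \<in> E" by blast
  define p where "p i = (f ^^ i) t" for i
  have p: "p i \<in> T" for i
    unfolding p_def using \<open>t \<in> T\<close> fg by (induction i) auto
  have "p 0 = expand (\<lambda>i. g (p i))"
  proof (rule expand_eqI)
    show "p i = B (p (Suc i) + g (p i))" for i
      using fg[OF p[of i]] unfolding p_def funpow.simps o_def by blast
    show "bounded (range p)"
      by (rule bounded_subset[OF compact_imp_bounded[OF T(2)]]) (use p in blast)
    show "bounded (range (\<lambda>i. g (p i)))"
      by (rule bounded_digits[OF E]) (use g[OF p] in blast)
  qed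
  moreover have "p 0 = t" by (simp add: p_def)
  moreover have "range (\<lambda>i. g (p i)) \<subseteq> E" using g[OF p] by (auto simp only: image_subset_iff)
  ultimately show "t \<in> attractor E"
    unfolding attractor_def by (metis imageI mem_Collect_eq)
next
  fix t assume "t \<in> attractor E"
  then obtain e where e: "t = expand e" "range e \<subseteq> E" unfolding attractor_def by auto
  obtain s where "s \<in> T" using T(1) by blast
  have in_T: "(\<Sum>k<m. (B ^^ Suc k) (e k)) + (B ^^ m) s' \<in> T" if "s' \<in> T" for m s'
    using that
  proof (induction m arbitrary: s')
    case (Suc m)
    have "B (s' + e m) \<in> T"
    proof (subst T_eq, intro CollectI exI conjI)
      show "B (s' + e m) = B (s' + e m)" ..
      show "s' \<in> T" by (rule Suc.prems)
      show "e m \<in> E" using e(2) by (auto simp only: image_subset_iff)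
    qed
    from Suc.IH[OF this]
    have "(\<Sum>k<m. (B ^^ Suc k) (e k)) + (B ^^ Suc m) (s' + e m) \<in> T"
      by (simp only: funpow_Suc_right o_def)
    thus ?case
      by (simp only: linear_add[OF linear_iterate] sum.lessThan_Suc add_ac)
  qed simp
  show "t \<in> T"
    unfolding e(1)
  proof (rule closed_sequentially[OF compact_imp_closed[OF T(2)]])
    show "(\<lambda>m. (\<Sum>k<m. (B ^^ Suc k) (e k)) + (B ^^ m) s) \<longlonglongrightarrow> expand e"
      by (rule expand_partial_sums_converge[OF bounded_digits[OF E e(2)], of "\<lambda>_. s"]) simp
    show "(\<Sum>k<m. (B ^^ Suc k) (e k)) + (B ^^ m) s \<in> T" for m
      by (rule in_T[OF \<open>s \<in> T\<close>])
  qed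
qed

end

section \<open>Translation-invariant measures\<close>

text \<open>If \<open>s\<^sub>k \<longlonglongrightarrow> t\<close> then every point of the open set \<open>U - t\<close> lies in \<open>U - s\<^sub>k\<close> for all large \<open>k\<close>, so
  the measure of \<open>U - t\<close> is at most that of \<open>U\<close>, by Fatou's argument. Translating back by \<open>- t\<close> gives
  the reverse inequality. Restricting to open sets makes this one-sided limit sufficient.\<close>
lemma open_translation_invariance_limit:
  fixes N :: "'a::euclidean_space measure"
  assumes sets_N: "sets N = sets borel"
    and dense: "\<And>t. \<exists>s. s \<longlonglongrightarrow> t \<and>
      (\<forall>k U. open U \<longrightarrow> emeasure N ((\<lambda>x. x + s k) -` U) = emeasure N U)"
    and U: "open U"
  shows "emeasure N ((\<lambda>x. x + t) -` U) = emeasure N U"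
proof -
  have opn: "open ((\<lambda>x::'a. x + t) -` U)" if "open U" for U t
    using that by (intro open_vimage continuous_intros)
  have le: "emeasure N ((\<lambda>x. x + t) -` U) \<le> emeasure N U" if "open U" for U t
  proof -
    obtain s where s: "s \<longlonglongrightarrow> t"
      and inv: "\<And>k. emeasure N ((\<lambda>x. x + s k) -` U) = emeasure N U"
      using dense \<open>open U\<close> by metis
    define F where "F n = (\<Inter>k\<in>{n..}. (\<lambda>x. x + s k) -` U)" for n
    have meas: "F n \<in> sets N" for n
      unfolding F_def sets_N using opn[OF \<open>open U\<close>]
      by (intro sets.countable_INT'' borel_open) auto
    have "(\<lambda>x. x + t) -` U \<subseteq> (\<Union>n. F n)"
    proof
      fix x assume "x \<in> (\<lambda>x. x + t) -` U"
      hence "\<forall>\<^sub>F k in sequentially. x + s k \<in> U"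
        using topological_tendstoD[OF tendsto_add[OF tendsto_const s] \<open>open U\<close>] by simp
      thus "x \<in> (\<Union>n. F n)" by (auto simp: F_def eventually_sequentially)
    qed
    hence "emeasure N ((\<lambda>x. x + t) -` U) \<le> emeasure N (\<Union>n. F n)"
      using meas by (intro emeasure_mono) auto
    also have "\<dots> = (SUP n. emeasure N (F n))"
      using meas by (intro SUP_emeasure_incseq[symmetric]) (auto simp: incseq_def F_def)
    also have "\<dots> \<le> emeasure N U"
    proof (rule SUP_least)
      fix n
      have "emeasure N (F n) \<le> emeasure N ((\<lambda>x. x + s n) -` U)"
        using opn[OF \<open>open U\<close>] by (intro emeasure_mono) (auto simp: F_def sets_N)
      thus "emeasure N (F n) \<le> emeasure N U" by (simp add: inv)
    qed
    finally show ?thesis .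
  qed
  have "emeasure N ((\<lambda>x. x + (- t)) -` ((\<lambda>x. x + t) -` U)) \<le> emeasure N ((\<lambda>x. x + t) -` U)"
    by (rule le[OF opn[OF U]])
  hence "emeasure N U \<le> emeasure N ((\<lambda>x. x + t) -` U)"
    by (simp add: vimage_def)
  with le[OF U] show ?thesis by (rule antisym)
qed

lemma emeasure_lborel_reflect:
  fixes U :: "'a::euclidean_space set"
  assumes [measurable]: "U \<in> sets borel"
  shows "emeasure lborel {y. x - y \<in> U} = emeasure lborel U"
proof -
  have "lborel = distr lborel borel (\<lambda>y::'a. x + (-1) *\<^sub>R y)"
    using lborel_affine[of "-1" x] by (simp add: density_1)
  hence "emeasure lborel U = emeasure (distr lborel borel (\<lambda>y. x + (-1) *\<^sub>R y)) U"
    by simp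
  also have "\<dots> = emeasure lborel ((\<lambda>y. x + (-1) *\<^sub>R y) -` U)"
    by (subst emeasure_distr) auto
  also have "(\<lambda>y. x + (-1) *\<^sub>R y) -` U = {y. x - y \<in> U}" by auto
  finally show ?thesis ..
qed

text \<open>The double integral of the indicator of \<open>x \<in> U \<and> x - y \<in> Q\<close> is evaluated in both orders.
  Integrating over \<open>y\<close> first gives the left-hand side. In the other order, translating the inner
  integral by \<open>y\<close> turns the condition into \<open>x + y \<in> U \<and> x \<in> Q\<close>, which gives the right-hand side. Only
  intersections of translates of \<open>U\<close> and \<open>Q\<close> are moved, so invariance on open sets is enough.\<close>
lemma translation_invariant_proportional:
  fixes N :: "'a::euclidean_space measure"
  assumes "sigma_finite_measure N" and sets_N [measurable_cong]: "sets N = sets borel"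
    and inv: "\<And>U t. open U \<Longrightarrow> emeasure N ((\<lambda>x. x + t) -` U) = emeasure N U"
    and U: "open U" and Q: "open Q"
  shows "emeasure N U * emeasure lborel Q = emeasure N Q * emeasure lborel U"
proof -
  interpret N: sigma_finite_measure N by fact
  interpret pair_sigma_finite N lborel ..
  have sp: "space N = UNIV" using sets_eq_imp_space_eq[OF sets_N] by simp
  note [measurable] = borel_open[OF U] borel_open[OF Q]
  have "emeasure N U * emeasure lborel Q = (\<integral>\<^sup>+x. indicator U x * emeasure lborel Q \<partial>N)"
    by (simp add: nn_integral_multc)
  also have "\<dots> = (\<integral>\<^sup>+x. (\<integral>\<^sup>+y. indicator U x * indicator Q (x - y) \<partial>lborel) \<partial>N)"
  proof (rule nn_integral_cong)
    fix x
    have "(\<integral>\<^sup>+y. indicator U x * indicator Q (x - y) \<partial>lborel) =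
        indicator U x * (\<integral>\<^sup>+y. indicator {y. x - y \<in> Q} y \<partial>lborel)"
      by (subst nn_integral_cmult[symmetric]) (auto simp: indicator_def)
    also have "(\<integral>\<^sup>+y. indicator {y. x - y \<in> Q} y \<partial>lborel) = emeasure lborel Q"
      by (subst nn_integral_indicator) (auto simp: emeasure_lborel_reflect)
    finally show "indicator U x * emeasure lborel Q =
        (\<integral>\<^sup>+y. indicator U x * indicator Q (x - y) \<partial>lborel)" ..
  qed
  also have "\<dots> = (\<integral>\<^sup>+y. (\<integral>\<^sup>+x. indicator U x * indicator Q (x - y) \<partial>N) \<partial>lborel)"
    by (rule Fubini'[symmetric]) simp
  also have "\<dots> = (\<integral>\<^sup>+y. (\<integral>\<^sup>+x. indicator U (x + y) * indicator Q x \<partial>N) \<partial>lborel)"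
  proof (rule nn_integral_cong)
    fix y
    let ?V = "U \<inter> (\<lambda>x. x - y) -` Q"
    have V: "open ?V" using U Q by (intro open_Int open_vimage continuous_intros)
    have "(\<integral>\<^sup>+x. indicator U x * indicator Q (x - y) \<partial>N) = (\<integral>\<^sup>+x. indicator ?V x \<partial>N)"
      by (intro nn_integral_cong) (auto simp: indicator_def)
    also have "\<dots> = emeasure N ?V" using V by (intro nn_integral_indicator) (simp add: sets_N)
    also have "\<dots> = emeasure N ((\<lambda>x. x + y) -` ?V)" using inv[OF V] by simp
    also have "\<dots> = (\<integral>\<^sup>+x. indicator ((\<lambda>x. x + y) -` ?V) x \<partial>N)"
      by (intro nn_integral_indicator[symmetric], unfold sets_N, intro borel_open open_vimage V
          continuous_intros)
    also have "\<dots> = (\<integral>\<^sup>+x. indicator U (x + y) * indicator Q x \<partial>N)"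
      by (intro nn_integral_cong) (auto simp: indicator_def)
    finally show "(\<integral>\<^sup>+x. indicator U x * indicator Q (x - y) \<partial>N) =
        (\<integral>\<^sup>+x. indicator U (x + y) * indicator Q x \<partial>N)" .
  qed
  also have "\<dots> = (\<integral>\<^sup>+x. (\<integral>\<^sup>+y. indicator U (x + y) * indicator Q x \<partial>lborel) \<partial>N)"
    by (rule Fubini') simp
  also have "\<dots> = (\<integral>\<^sup>+x. indicator Q x * emeasure lborel U \<partial>N)"
  proof (rule nn_integral_cong)
    fix x
    have "(\<integral>\<^sup>+y. indicator U (x + y) * indicator Q x \<partial>lborel) =
        indicator Q x * (\<integral>\<^sup>+y. indicator U (x + y) \<partial>lborel)"
      by (subst nn_integral_cmult[symmetric]) (auto simp: mult.commute)
    also have "(\<integral>\<^sup>+y. indicator U (x + y) \<partial>lborel) = (\<integral>\<^sup>+y. indicator U y \<partial>distr lborel borel ((+) x))"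
      by (subst nn_integral_distr) auto
    finally show "(\<integral>\<^sup>+y. indicator U (x + y) * indicator Q x \<partial>lborel) =
        indicator Q x * emeasure lborel U"
      by (simp add: lborel_distr_plus)
  qed
  also have "\<dots> = emeasure N Q * emeasure lborel U"
    by (simp add: nn_integral_multc)
  finally show ?thesis .
qed

text \<open>The normalisation is imposed on a set \<open>H\<close> between the open and the closed unit cube, since
  a half-open cube tiles the space exactly while proportionality is known for open sets only.\<close>
lemma translation_invariant_eq_lborel:
  fixes N :: "'a::euclidean_space measure"
  assumes N: "sigma_finite_measure N" "sets N = sets borel"
    "\<And>U t. open U \<Longrightarrow> emeasure N ((\<lambda>x. x + t) -` U) = emeasure N U"
    and H: "H \<in> sets borel" "box 0 One \<subseteq> H" "H \<subseteq> cbox 0 One" "emeasure N H = 1"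
  shows "N = lborel"
proof -
  define c where "c = emeasure N (box 0 One)"
  have proportional: "emeasure N U = c * emeasure lborel U" if "open U" for U
    using translation_invariant_proportional[OF N that open_box[of 0 One]]
    by (simp add: c_def)
  have "c \<le> 1"
    unfolding c_def H(4)[symmetric] using H N(2) by (intro emeasure_mono) auto
  have "c \<noteq> 0"
  proof
    assume "c = 0"
    hence "emeasure N UNIV = 0" using proportional[of UNIV] by simp
    moreover have "emeasure N H \<le> emeasure N UNIV"
      using N(2) by (intro emeasure_mono) auto
    ultimately show False using H(4) by simp
  qed
  have c_inv: "inverse c * c = 1"
    using ennreal_divide_self[of c] \<open>c \<noteq> 0\<close> le_less_trans[OF \<open>c \<le> 1\<close> ennreal_one_less_top]
    by (simp add: divide_ennreal_def mult.commute)
  have "lborel = scale_measure (inverse c) N"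
  proof (rule lborel_eqI)
    fix l u :: 'a assume "\<And>b. b \<in> Basis \<Longrightarrow> l \<bullet> b \<le> u \<bullet> b"
    thus "emeasure (scale_measure (inverse c) N) (box l u) = (\<Prod>b\<in>Basis. (u - l) \<bullet> b)"
      by (simp add: proportional open_box mult.assoc[symmetric] c_inv)
  qed (simp add: N(2))
  hence lb: "emeasure lborel S = inverse c * emeasure N S" for S
    by (metis emeasure_scale_measure)
  have "emeasure lborel H = 1"
  proof (rule antisym)
    show "emeasure lborel H \<le> 1"
      using emeasure_mono[of H "cbox 0 One" lborel] H(3) by (simp add: emeasure_lborel_cbox_eq)
    show "1 \<le> emeasure lborel H"
      using emeasure_mono[of "box 0 One" H lborel] H(1,2) by simp
  qed
  hence "c = 1" using lb[of H] c_inv by (simp add: H(4))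
  thus ?thesis by (intro measure_eqI) (auto simp: N(2) lb)
qed

section \<open>Integer vectors and the unit cube\<close>
lemma vec_of_int_add: "vec_of_int (v + w) = vec_of_int v + vec_of_int w"
  by (simp add: vec_of_int_def vec_eq_iff)

lemma vec_of_int_diff: "vec_of_int (v - w) = vec_of_int v - vec_of_int w"
  by (simp add: vec_of_int_def vec_eq_iff)

lemma vec_of_int_uminus: "vec_of_int (- v) = - vec_of_int v"
  by (simp add: vec_of_int_def vec_eq_iff)

lemma vec_of_int_inj: "vec_of_int v = vec_of_int w \<longleftrightarrow> v = w"
  by (simp add: vec_of_int_def vec_eq_iff)

lemma vec_of_int_mult: "map_matrix real_of_int A *v vec_of_int w = vec_of_int (A *v w)"
  by (simp add: vec_of_int_def vec_eq_iff matrix_vector_mult_def)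

lemma finite_bounded_int_vectors:
  "finite {v :: int ^ 'n. norm (vec_of_int v) \<le> R}"
proof -
  let ?S = "{v :: int ^ 'n. norm (vec_of_int v) \<le> R}"
  have "vec_nth ` ?S \<subseteq> PiE UNIV (\<lambda>_. {- \<lceil>R\<rceil>..\<lceil>R\<rceil>})"
  proof (rule image_subsetI)
    fix v :: "int ^ 'n" assume v: "v \<in> ?S"
    have "- \<lceil>R\<rceil> \<le> v $ i \<and> v $ i \<le> \<lceil>R\<rceil>" for i
    proof -
      have "\<bar>real_of_int (v $ i)\<bar> \<le> R"
        using component_le_norm_cart[of "vec_of_int v" i] v by (simp add: vec_of_int_def)
      thus ?thesis by linarith
    qed
    thus "vec_nth v \<in> PiE UNIV (\<lambda>_. {- \<lceil>R\<rceil>..\<lceil>R\<rceil>})"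
      by (auto simp: PiE_UNIV_domain)
  qed
  hence "finite (vec_nth ` ?S)"
    by (rule finite_subset) (auto intro: finite_PiE)
  thus ?thesis by (rule finite_imageD) (auto simp: inj_on_def vec_eq_iff)
qed

definition unit_cube :: "(real ^ 'n) set" where
  "unit_cube = {x. \<forall>i. 0 \<le> x $ i \<and> x $ i < 1}"

lemma unit_cube_borel [measurable]: "unit_cube \<in> sets borel"
  unfolding unit_cube_def by measurable

lemma unit_cube_box: "box 0 (One :: real ^ 'n) \<subseteq> unit_cube" "unit_cube \<subseteq> cbox 0 (One :: real ^ 'n)"
proof -
  have one: "(One :: real ^ 'n) $ i = 1" for i
    by (subst cart_eq_inner_axis) (simp add: inner_sum_left_Basis axis_in_Basis_iff)
  show "box 0 (One :: real ^ 'n) \<subseteq> unit_cube"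
    unfolding unit_cube_def
    by (rule subsetI, simp only: mem_box_cart one zero_index mem_Collect_eq) (meson less_imp_le)
  show "unit_cube \<subseteq> cbox 0 (One :: real ^ 'n)"
    unfolding unit_cube_def
    by (rule subsetI, simp only: mem_box_cart one zero_index mem_Collect_eq) (meson less_imp_le)
qed

definition floor_vec :: "real ^ 'n \<Rightarrow> int ^ 'n" where
  "floor_vec x = (\<chi> i. \<lfloor>x $ i\<rfloor>)"

text \<open>The integer translates of the unit cube tile the space.\<close>
lemma floor_vec_unique: "x - vec_of_int v \<in> unit_cube \<longleftrightarrow> v = floor_vec x"
proof -
  have "(0 \<le> y - real_of_int k \<and> y - real_of_int k < 1) \<longleftrightarrow> k = \<lfloor>y\<rfloor>" for y k
    by linarith
  thus ?thesis by (simp add: unit_cube_def floor_vec_def vec_of_int_def vec_eq_iff)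
qed

lemma floor_vec_remainder_bounded: "bounded (range (\<lambda>k. y k - vec_of_int (floor_vec (y k))))"
proof (rule bounded_subset[OF bounded_cbox])
  show "range (\<lambda>k. y k - vec_of_int (floor_vec (y k))) \<subseteq> cbox 0 One"
    using unit_cube_box(2) floor_vec_unique by blast
qed

section \<open>Expansions with integer digits\<close>
locale expanding_matrix = iterated_contraction B M r
  for B :: "real ^ 'n \<Rightarrow> real ^ 'n" and M r :: real +
  fixes A :: "int ^ 'n ^ 'n"
  assumes AB: "map_matrix real_of_int A *v B x = x"
    and BA: "B (map_matrix real_of_int A *v x) = x"
begin

lemma B_vec_of_int: "B (vec_of_int (A *v w)) = vec_of_int w"
  using BA[of "vec_of_int w"] by (simp add: vec_of_int_mult)

lemma A_inj: "A *v v = A *v w \<longleftrightarrow> v = w"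
  using B_vec_of_int by (metis vec_of_int_inj)

definition encode :: "(nat \<Rightarrow> int ^ 'n) \<Rightarrow> real ^ 'n" where
  "encode x = expand (\<lambda>k. vec_of_int (x k))"

lemma bounded_int_digits:
  assumes "finite S" "range x \<subseteq> S"
  shows "bounded (range (\<lambda>k. vec_of_int (x k)))"
  by (rule bounded_subset[OF finite_imp_bounded[OF finite_imageI[OF assms(1), of vec_of_int]]])
     (use assms(2) in auto)

lemma encode_shift:
  assumes "finite S" "range x \<subseteq> S"
  shows "encode x = B (vec_of_int (x 0) + encode (\<lambda>k. x (Suc k)))"
  unfolding encode_def by (rule expand_shift[OF bounded_int_digits[OF assms]])

end

section \<open>The lattice sum of the law of a random expansion\<close>
locale digit_transversal = expanding_matrix B M r A
  for B :: "real ^ 'n \<Rightarrow> real ^ 'n" and M r :: real and A :: "int ^ 'n ^ 'n" +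
  fixes C :: "(int ^ 'n) set"
  assumes finite_C: "finite C" and C_transversal: "coset_transversal A C"
begin

lemma C_nonempty: "C \<noteq> {}"
  using C_transversal unfolding coset_transversal_def by auto

abbreviation digit_measure :: "(int ^ 'n) measure" where
  "digit_measure \<equiv> uniform_count_measure C"

abbreviation \<beta> :: "(nat \<Rightarrow> int ^ 'n) measure" where
  "\<beta> \<equiv> bernoulli_measure C"

sublocale digit: prob_space digit_measure
  by (rule prob_space_uniform_count_measure[OF finite_C C_nonempty])

sublocale sequence_space digit_measure ..

lemma bernoulli_eq: "\<beta> = S"
  by (simp add: bernoulli_measure_def)

sublocale \<beta>: prob_space \<beta>
  unfolding bernoulli_eq by (rule P.prob_space_axioms)

lemma space_bernoulli: "space \<beta> = {x. range x \<subseteq> C}"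
  by (auto simp: bernoulli_eq space_PiM space_uniform_count_measure PiE_iff)

lemma encode_measurable [measurable]: "encode \<in> \<beta> \<rightarrow>\<^sub>M borel"
proof -
  have "(\<lambda>x. (B ^^ Suc k) (vec_of_int (x k))) \<in> \<beta> \<rightarrow>\<^sub>M borel" for k
  proof (rule measurable_compose[of "\<lambda>x. x k" _ digit_measure])
    show "(\<lambda>x. x k) \<in> \<beta> \<rightarrow>\<^sub>M digit_measure"
      unfolding bernoulli_eq by (rule measurable_component_singleton) simp
    show "(\<lambda>c. (B ^^ Suc k) (vec_of_int c)) \<in> digit_measure \<rightarrow>\<^sub>M borel"
      by (simp add: measurable_cong_sets[OF sets_uniform_count_measure_count_space refl])
  qed
  thus ?thesis unfolding encode_def expand_def by (intro borel_measurable_suminf)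
qed

lemma B_measurable [measurable]: "B \<in> borel_measurable borel"
  by (intro borel_measurable_continuous_onI linear_continuous_on
      linear_conv_bounded_linear[THEN iffD1, OF lin])

text \<open>A Bernoulli sequence is a uniform digit followed by an independent Bernoulli sequence.\<close>
lemma bernoulli_self_similar:
  assumes [measurable]: "f \<in> borel_measurable borel"
  shows "(\<integral>\<^sup>+x. f (encode x) \<partial>\<beta>) =
    (\<Sum>c\<in>C. \<integral>\<^sup>+x. f (B (vec_of_int c + encode x)) \<partial>\<beta>) / of_nat (card C)"
proof -
  have [measurable]: "vec_of_int \<in> digit_measure \<rightarrow>\<^sub>M borel"
    by (simp add: measurable_cong_sets[OF sets_uniform_count_measure_count_space refl])
  have case_nat [measurable]:
    "(\<lambda>(s, \<omega>). case_nat s \<omega>) \<in> digit_measure \<Otimes>\<^sub>M \<beta> \<rightarrow>\<^sub>M \<beta>"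
    unfolding bernoulli_eq by measurable
  have "(\<integral>\<^sup>+x. f (encode x) \<partial>\<beta>) =
      (\<integral>\<^sup>+x. f (encode x) \<partial>distr (digit_measure \<Otimes>\<^sub>M \<beta>) \<beta> (\<lambda>(s, \<omega>). case_nat s \<omega>))"
    unfolding bernoulli_eq by (simp add: PiM_iter)
  also have "\<dots> = (\<integral>\<^sup>+p. f (encode (case_nat (fst p) (snd p))) \<partial>(digit_measure \<Otimes>\<^sub>M \<beta>))"
    by (subst nn_integral_distr) (auto simp: case_prod_beta)
  also have "\<dots> = (\<integral>\<^sup>+p. f (B (vec_of_int (fst p) + encode (snd p))) \<partial>(digit_measure \<Otimes>\<^sub>M \<beta>))"
  proof (intro nn_integral_cong)
    fix p assume "p \<in> space (digit_measure \<Otimes>\<^sub>M \<beta>)"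
    hence "range (case_nat (fst p) (snd p)) \<subseteq> C"
      by (auto simp: space_pair_measure space_bernoulli space_uniform_count_measure
          image_subset_iff split: nat.split)
    from encode_shift[OF finite_C this]
    show "f (encode (case_nat (fst p) (snd p))) = f (B (vec_of_int (fst p) + encode (snd p)))"
      by simp
  qed
  also have "\<dots> = (\<integral>\<^sup>+c. \<integral>\<^sup>+x. f (B (vec_of_int c + encode x)) \<partial>\<beta> \<partial>digit_measure)"
    by (subst \<beta>.nn_integral_fst[symmetric]) auto
  also have "\<dots> = (\<Sum>c\<in>C. \<integral>\<^sup>+x. f (B (vec_of_int c + encode x)) \<partial>\<beta>) / of_nat (card C)"
  proof -
    have "ennreal (1 / real (card C)) = inverse (of_nat (card C))"
      using finite_C C_nonempty
      by (simp add: inverse_ennreal ennreal_of_nat_eq_real_of_nat card_gt_0_iff inverse_eq_divide)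
    thus ?thesis
      unfolding uniform_count_measure_def
      by (simp add: nn_integral_point_measure_finite[OF finite_C] sum_distrib_left[symmetric]
          divide_ennreal_def mult.commute)
  qed
  finally show ?thesis .
qed

text \<open>The law of \<open>encode\<close> convolved with counting measure on the integer vectors. Presenting it
  as an image measure of a product makes Fubini's theorem available.\<close>
definition lattice_sum :: "(real ^ 'n) measure" where
  "lattice_sum = distr (count_space UNIV \<Otimes>\<^sub>M \<beta>) borel (\<lambda>(v, x). encode x - vec_of_int v)"

lemma sets_lattice_sum [measurable_cong]: "sets lattice_sum = sets borel"
  by (simp add: lattice_sum_def)

lemma space_lattice_sum: "space lattice_sum = UNIV"
  by (simp add: lattice_sum_def)

lemma lattice_sum_measurable [measurable]:
  "(\<lambda>(v, x). encode x - vec_of_int v) \<in> count_space UNIV \<Otimes>\<^sub>M \<beta> \<rightarrow>\<^sub>M borel"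
proof -
  have [measurable]: "vec_of_int \<in> count_space UNIV \<rightarrow>\<^sub>M borel" by simp
  show ?thesis by measurable
qed

lemma nn_integral_lattice_sum:
  assumes [measurable]: "f \<in> borel_measurable borel"
  shows "(\<integral>\<^sup>+y. f y \<partial>lattice_sum) =
    (\<integral>\<^sup>+v. \<integral>\<^sup>+x. f (encode x - vec_of_int v) \<partial>\<beta> \<partial>count_space UNIV)"
proof -
  have [measurable]: "vec_of_int \<in> count_space UNIV \<rightarrow>\<^sub>M borel" by simp
  have "(\<integral>\<^sup>+y. f y \<partial>lattice_sum) =
      (\<integral>\<^sup>+p. f (encode (snd p) - vec_of_int (fst p)) \<partial>(count_space UNIV \<Otimes>\<^sub>M \<beta>))"
    unfolding lattice_sum_def by (subst nn_integral_distr) (auto simp: case_prod_beta)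
  thus ?thesis by (subst (asm) \<beta>.nn_integral_fst[symmetric]) auto
qed

lemma emeasure_lattice_sum:
  assumes [measurable]: "E \<in> sets borel"
  shows "emeasure lattice_sum E =
    (\<integral>\<^sup>+v. emeasure \<beta> {x \<in> space \<beta>. encode x - vec_of_int v \<in> E} \<partial>count_space UNIV)"
proof -
  have "emeasure lattice_sum E = (\<integral>\<^sup>+y. indicator E y \<partial>lattice_sum)" by simp
  also have "\<dots> = (\<integral>\<^sup>+v. \<integral>\<^sup>+x. indicator E (encode x - vec_of_int v) \<partial>\<beta> \<partial>count_space UNIV)"
    by (rule nn_integral_lattice_sum) simp
  also have "\<dots> = (\<integral>\<^sup>+v. emeasure \<beta> {x \<in> space \<beta>. encode x - vec_of_int v \<in> E} \<partial>count_space UNIV)"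
  proof (rule nn_integral_cong)
    fix v
    have "(\<integral>\<^sup>+x. indicator E (encode x - vec_of_int v) \<partial>\<beta>) =
        (\<integral>\<^sup>+x. indicator {x \<in> space \<beta>. encode x - vec_of_int v \<in> E} x \<partial>\<beta>)"
      by (intro nn_integral_cong) (simp add: indicator_def)
    also have "\<dots> = emeasure \<beta> {x \<in> space \<beta>. encode x - vec_of_int v \<in> E}"
      by (rule nn_integral_indicator) measurable
    finally show "(\<integral>\<^sup>+x. indicator E (encode x - vec_of_int v) \<partial>\<beta>) =
        emeasure \<beta> {x \<in> space \<beta>. encode x - vec_of_int v \<in> E}" .
  qed
  finally show ?thesis .
qed

text \<open>Each integer vector \<open>w\<close> is \<open>A v - c\<close> for exactly one \<open>c \<in> C\<close>: the representative of \<open>- w\<close>.\<close>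
lemma transversal_indicator:
  "(\<Sum>c\<in>C. indicator (range (\<lambda>v. A *v v - c)) w) = (1 :: ennreal)"
proof -
  obtain c0 where c0: "c0 \<in> C" "- w - c0 \<in> range (\<lambda>v. A *v v)"
    and uniq: "\<And>c. c \<in> C \<Longrightarrow> - w - c \<in> range (\<lambda>v. A *v v) \<Longrightarrow> c = c0"
    using C_transversal unfolding coset_transversal_def by metis
  have neg: "A *v (- v) = - (A *v v)" for v
    using matrix_vector_mult_diff_distrib[of A 0 v] by simp
  have iff: "w \<in> range (\<lambda>v. A *v v - c) \<longleftrightarrow> - w - c \<in> range (\<lambda>v. A *v v)" for c
  proof
    assume "w \<in> range (\<lambda>v. A *v v - c)"
    then obtain v where v: "w = A *v v - c" by blast
    show "- w - c \<in> range (\<lambda>v. A *v v)"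
      by (rule range_eqI[of _ _ "- v"]) (simp only: neg v, simp)
  next
    assume "- w - c \<in> range (\<lambda>v. A *v v)"
    then obtain v where v: "- w - c = A *v v" by blast
    show "w \<in> range (\<lambda>v. A *v v - c)"
      by (rule range_eqI[of _ _ "- v"]) (simp only: neg v[symmetric], simp)
  qed
  have "(\<Sum>c\<in>C. indicator (range (\<lambda>v. A *v v - c)) w) = (\<Sum>c\<in>C. if c = c0 then 1 else (0::ennreal))"
  proof (rule sum.cong[OF refl])
    fix c assume "c \<in> C"
    hence "- w - c \<in> range (\<lambda>v. A *v v) \<longleftrightarrow> c = c0"
      using c0(2) uniq by blast
    thus "indicator (range (\<lambda>v. A *v v - c)) w = (if c = c0 then 1 else (0::ennreal))"
      by (simp only: indicator_def iff of_bool_def)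
  qed
  thus ?thesis using c0(1) finite_C by simp
qed

text \<open>Self-similarity replaces \<open>encode x - v\<close> by \<open>B (encode x - (A v - c))\<close>, averaged over \<open>c \<in> C\<close>.
  Since \<open>v\<close> ranges over all integer vectors, \<open>A v - c\<close> does so too, once each.\<close>
lemma lattice_sum_scaling:
  assumes [measurable]: "E \<in> sets borel"
  shows "of_nat (card C) * emeasure lattice_sum E = emeasure lattice_sum (B -` E)"
proof -
  define h where "h w = (\<integral>\<^sup>+x. indicator E (B (encode x - vec_of_int w)) \<partial>\<beta> :: ennreal)" for w
  have card_nz: "of_nat (card C) \<noteq> (0 :: ennreal)" "of_nat (card C) \<noteq> (\<top> :: ennreal)"
    using finite_C C_nonempty by auto
  have step: "of_nat (card C) * (\<integral>\<^sup>+x. indicator E (encode x - vec_of_int v) \<partial>\<beta>) =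
      (\<Sum>c\<in>C. h (A *v v - c))" for v
  proof -
    have B_eq: "B (vec_of_int c + y) - vec_of_int v = B (y - vec_of_int (A *v v - c))" for c y
      by (simp add: vec_of_int_diff linear_diff[OF lin] linear_add[OF lin] B_vec_of_int)
    have cancel: "of_nat (card C) * (a / of_nat (card C)) = a" for a :: ennreal
      using card_nz by (metis ennreal_mult_divide_eq ennreal_times_divide mult.commute)
    show ?thesis
      by (subst bernoulli_self_similar[of "\<lambda>y. indicator E (y - vec_of_int v)"])
         (simp_all add: B_eq h_def cancel)
  qed
  have reindex: "(\<integral>\<^sup>+v. h (A *v v - c) \<partial>count_space UNIV) =
      (\<integral>\<^sup>+w. h w * indicator (range (\<lambda>v. A *v v - c)) w \<partial>count_space UNIV)" for c
  proof -
    have "bij_betw (\<lambda>v. A *v v - c) UNIV (range (\<lambda>v. A *v v - c))"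
      by (auto simp: bij_betw_def inj_on_def A_inj)
    hence "(\<integral>\<^sup>+v. h (A *v v - c) \<partial>count_space UNIV) =
        (\<integral>\<^sup>+w. h w \<partial>count_space (range (\<lambda>v. A *v v - c)))"
      by (rule nn_integral_bij_count_space)
    thus ?thesis by (simp add: nn_integral_count_space_indicator)
  qed
  have "of_nat (card C) * emeasure lattice_sum E =
      of_nat (card C) * (\<integral>\<^sup>+y. indicator E y \<partial>lattice_sum)" by simp
  also have "\<dots> = (\<integral>\<^sup>+v. (\<Sum>c\<in>C. h (A *v v - c)) \<partial>count_space UNIV)"
    by (subst nn_integral_lattice_sum) (simp_all add: step nn_integral_cmult[symmetric])
  also have "\<dots> = (\<Sum>c\<in>C. \<integral>\<^sup>+v. h (A *v v - c) \<partial>count_space UNIV)"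
    by (rule nn_integral_sum) simp
  also have "\<dots> = (\<integral>\<^sup>+w. (\<Sum>c\<in>C. h w * indicator (range (\<lambda>v. A *v v - c)) w) \<partial>count_space UNIV)"
    unfolding reindex by (rule nn_integral_sum[symmetric]) simp
  also have "\<dots> = (\<integral>\<^sup>+w. h w \<partial>count_space UNIV)"
    by (simp add: sum_distrib_left[symmetric] transversal_indicator)
  also have "\<dots> = (\<integral>\<^sup>+y. indicator E (B y) \<partial>lattice_sum)"
    by (subst nn_integral_lattice_sum, simp, unfold h_def, rule refl)
  also have "\<dots> = (\<integral>\<^sup>+y. indicator (B -` E) y \<partial>lattice_sum)"
    by (simp add: indicator_def)
  also have "\<dots> = emeasure lattice_sum (B -` E)"
  proof (rule nn_integral_indicator)
    have "B -` E \<inter> space borel \<in> sets borel" by measurable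
    thus "B -` E \<in> sets lattice_sum" by (simp add: sets_lattice_sum)
  qed
  finally show ?thesis .
qed

definition period :: "real ^ 'n \<Rightarrow> bool" where
  "period t \<longleftrightarrow>
    (\<forall>E\<in>sets borel. emeasure lattice_sum ((\<lambda>y. y + t) -` E) = emeasure lattice_sum E)"

lemma translate_borel:
  assumes "E \<in> sets borel"
  shows "(\<lambda>y::real^'n. y + t) -` E \<in> sets borel"
proof -
  have "(\<lambda>y::real^'n. y + t) -` E \<inter> space borel \<in> sets borel"
    using assms by measurable
  thus ?thesis by simp
qed

lemma period_integer: "period (vec_of_int w)"
  unfolding period_def
proof
  fix E :: "(real ^ 'n) set" assume E: "E \<in> sets borel"
  define g where "g v = emeasure \<beta> {x \<in> space \<beta>. encode x - vec_of_int v \<in> E}" for v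
  have "emeasure lattice_sum ((\<lambda>y. y + vec_of_int w) -` E) =
      (\<integral>\<^sup>+v. g (v - w) \<partial>count_space UNIV)"
    by (subst emeasure_lattice_sum[OF translate_borel[OF E]])
       (simp add: g_def vec_of_int_diff algebra_simps)
  also have "\<dots> = (\<integral>\<^sup>+v. g v \<partial>count_space UNIV)"
    by (rule nn_integral_bij_count_space) (use bij_plus_right[of "- w"] in simp)
  also have "\<dots> = emeasure lattice_sum E"
    by (simp add: g_def emeasure_lattice_sum[OF E])
  finally show "emeasure lattice_sum ((\<lambda>y. y + vec_of_int w) -` E) = emeasure lattice_sum E" .
qed

text \<open>A translation by \<open>B t\<close> becomes one by \<open>t\<close> after pulling back along \<open>B\<close>, and pulling back only
  rescales the measure, by a factor that is positive and finite.\<close>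
lemma period_B:
  assumes "period t"
  shows "period (B t)"
  unfolding period_def
proof
  fix E :: "(real ^ 'n) set" assume E: "E \<in> sets borel"
  have BE: "B -` E \<in> sets borel"
    using measurable_sets[OF B_measurable E] by simp
  have "of_nat (card C) * emeasure lattice_sum ((\<lambda>y. y + B t) -` E) =
      emeasure lattice_sum (B -` (\<lambda>y. y + B t) -` E)"
    by (rule lattice_sum_scaling[OF translate_borel[OF E]])
  also have "B -` (\<lambda>y. y + B t) -` E = (\<lambda>y. y + t) -` B -` E"
    by (auto simp: linear_add[OF lin])
  also have "emeasure lattice_sum \<dots> = emeasure lattice_sum (B -` E)"
    using assms BE unfolding period_def by blast
  also have "\<dots> = of_nat (card C) * emeasure lattice_sum E"
    by (rule lattice_sum_scaling[OF E, symmetric])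
  finally have "of_nat (card C) * emeasure lattice_sum ((\<lambda>y. y + B t) -` E) =
      of_nat (card C) * emeasure lattice_sum E" .
  moreover have "of_nat (card C) \<noteq> (0 :: ennreal)" "of_nat (card C) \<noteq> (\<top> :: ennreal)"
    using finite_C C_nonempty by auto
  ultimately show "emeasure lattice_sum ((\<lambda>y. y + B t) -` E) = emeasure lattice_sum E"
    by (simp only: ennreal_mult_cancel_left) blast
qed

text \<open>Rounding \<open>A\<^sup>k t\<close> to an integer vector and applying \<open>B\<^sup>k\<close> yields a period whose distance to \<open>t\<close>
  is \<open>B\<^sup>k\<close> of a point in the unit cube.\<close>
lemma period_dense: "\<exists>s. s \<longlonglongrightarrow> t \<and> (\<forall>k. period (s k))"
proof -
  let ?R = "\<lambda>x. map_matrix real_of_int A *v x"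
  define y where "y k = (?R ^^ k) t" for k
  define s where "s k = (B ^^ k) (vec_of_int (floor_vec (y k)))" for k
  have "(B ^^ k) ((?R ^^ k) z) = z" for k z
  proof (induction k arbitrary: z)
    case (Suc k)
    have "(B ^^ Suc k) ((?R ^^ Suc k) z) = (B ^^ k) (B (?R ((?R ^^ k) z)))"
      by (simp only: funpow_Suc_right[of k B] funpow.simps(2)[of k ?R] o_def)
    thus ?case by (simp only: BA Suc.IH)
  qed simp
  hence diff: "t - s k = (B ^^ k) (y k - vec_of_int (floor_vec (y k)))" for k
    by (simp only: s_def y_def linear_diff[OF linear_iterate])
  have "(\<lambda>k. t - s k) \<longlonglongrightarrow> 0"
    unfolding diff by (rule iterate_LIMSEQ_zero[OF floor_vec_remainder_bounded])
  from tendsto_diff[OF tendsto_const[of t] this] have "s \<longlonglongrightarrow> t" by simp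
  moreover have "period ((B ^^ k) (vec_of_int w))" for k w
    by (induction k) (simp_all add: period_integer period_B)
  ultimately show ?thesis by (intro exI[of _ s] conjI) (simp_all add: s_def)
qed

text \<open>For every sequence \<open>x\<close> exactly one integer vector moves \<open>encode x\<close> into the unit cube.\<close>
lemma emeasure_lattice_sum_unit_cube: "emeasure lattice_sum unit_cube = 1"
proof -
  interpret pair_sigma_finite "count_space (UNIV :: (int ^ 'n) set)" \<beta>
    by (intro pair_sigma_finite.intro sigma_finite_measure_count_space \<beta>.sigma_finite_measure_axioms)
  let ?g = "\<lambda>(v, x). encode x - vec_of_int v"
  let ?E = "?g -` unit_cube \<inter> space (count_space UNIV \<Otimes>\<^sub>M \<beta>)"
  have "emeasure lattice_sum unit_cube = emeasure (count_space UNIV \<Otimes>\<^sub>M \<beta>) ?E"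
    unfolding lattice_sum_def by (rule emeasure_distr) auto
  also have "\<dots> = (\<integral>\<^sup>+x. emeasure (count_space UNIV) ((\<lambda>v. (v, x)) -` ?E) \<partial>\<beta>)"
    by (rule emeasure_pair_measure_alt2) measurable
  also have "\<dots> = (\<integral>\<^sup>+x. 1 \<partial>\<beta>)"
  proof (rule nn_integral_cong)
    fix x assume "x \<in> space \<beta>"
    hence "(\<lambda>v. (v, x)) -` ?E = {floor_vec (encode x)}"
      by (auto simp: space_pair_measure floor_vec_unique)
    thus "emeasure (count_space UNIV) ((\<lambda>v. (v, x)) -` ?E) = 1" by simp
  qed
  also have "\<dots> = 1" by (simp add: \<beta>.emeasure_space_1)
  finally show ?thesis .
qed

lemma lattice_sum_sigma_finite: "sigma_finite_measure lattice_sum"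
proof
  let ?Q = "range (\<lambda>w. (\<lambda>y. y + vec_of_int w) -` unit_cube)"
  have "y \<in> \<Union>?Q" for y :: "real ^ 'n"
  proof -
    have "y + vec_of_int (- floor_vec y) \<in> unit_cube"
      using floor_vec_unique[of y "floor_vec y"] by (simp add: vec_of_int_uminus)
    thus ?thesis by blast
  qed
  moreover have "emeasure lattice_sum a = 1" if "a \<in> ?Q" for a
    using that period_integer unit_cube_borel emeasure_lattice_sum_unit_cube
    unfolding period_def by auto
  ultimately show "\<exists>Q. countable Q \<and> Q \<subseteq> sets lattice_sum \<and> \<Union>Q = space lattice_sum \<and>
      (\<forall>a\<in>Q. emeasure lattice_sum a \<noteq> \<infinity>)"
    by (intro exI[of _ ?Q] conjI)
       (auto simp: sets_lattice_sum space_lattice_sum intro!: translate_borel)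
qed

lemma lattice_sum_eq_lborel: "lattice_sum = lborel"
proof (rule translation_invariant_eq_lborel[OF lattice_sum_sigma_finite sets_lattice_sum])
  show "emeasure lattice_sum ((\<lambda>y. y + t) -` U) = emeasure lattice_sum U" if "open U" for U t
  proof (rule open_translation_invariance_limit[OF sets_lattice_sum _ that])
    fix t
    obtain s where "s \<longlonglongrightarrow> t" "\<And>k. period (s k)" using period_dense by blast
    thus "\<exists>s. s \<longlonglongrightarrow> t \<and> (\<forall>k U. open U \<longrightarrow>
        emeasure lattice_sum ((\<lambda>x. x + s k) -` U) = emeasure lattice_sum U)"
      unfolding period_def by (meson borel_open)
  qed
qed (use unit_cube_box emeasure_lattice_sum_unit_cube in auto)

end

section \<open>Paths in the nucleus as expansions\<close>

context expanding_matrix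
begin

lemma encode_diff:
  assumes "finite S" "range x \<subseteq> S" "range y \<subseteq> S"
  shows "encode x - encode y = expand (\<lambda>k. vec_of_int (x k) - vec_of_int (y k))"
  unfolding encode_def
  by (rule expand_diff[symmetric]) (intro bounded_int_digits[OF assms(1)] assms(2,3))+

text \<open>Applying \<open>B\<close> to the defining equation of the self-affine set yields the fixed-point equation that
  characterises the attractor among nonempty compact sets, so the definite description is proper.\<close>
lemma self_affine_set_attractor:
  assumes D: "finite D" "D \<noteq> {}"
  shows "self_affine_set A D = attractor (vec_of_int ` D)"
proof -
  let ?R = "\<lambda>t. map_matrix real_of_int A *v t" and ?E = "vec_of_int ` D"
  have E: "compact ?E" using D(1) by (intro finite_imp_compact) simp
  have iff: "?R ` T = (\<Union>d\<in>D. (\<lambda>t. t + vec_of_int d) ` T) \<longleftrightarrow>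
      T = {B (t + d) | t d. t \<in> T \<and> d \<in> ?E}" for T
  proof -
    let ?U = "\<Union>d\<in>D. (\<lambda>t. t + vec_of_int d) ` T"
    have "{B (t + d) | t d. t \<in> T \<and> d \<in> ?E} = B ` ?U" by blast
    moreover have "?R ` T = ?U \<longleftrightarrow> T = B ` ?U"
    proof
      assume eq: "?R ` T = ?U"
      show "T = B ` ?U" unfolding eq[symmetric] image_image BA by simp
    next
      assume "T = B ` ?U"
      hence "?R ` T = ?R ` B ` ?U" by (rule arg_cong)
      also have "\<dots> = ?U" unfolding image_image AB by simp
      finally show "?R ` T = ?U" .
    qed
    ultimately show ?thesis by (simp only:)
  qed
  obtain d0 where "d0 \<in> D" using D(2) by blast
  hence "(\<lambda>_. vec_of_int d0) \<in> {e :: nat \<Rightarrow> real ^ 'n. range e \<subseteq> ?E}" by simp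
  hence "attractor ?E \<noteq> {}" unfolding attractor_def by blast
  thus ?thesis
    unfolding self_affine_set_def iff
    by (intro the_equality conjI attractor_compact[OF E] attractor_eq[OF E])
       (assumption, elim conjE, rule attractor_unique[OF E])
qed

lemma mem_self_affine_set:
  assumes "finite D" "D \<noteq> {}"
  shows "t \<in> self_affine_set A D \<longleftrightarrow> (\<exists>d. range d \<subseteq> D \<and> t = encode d)"
proof
  assume "t \<in> self_affine_set A D"
  then obtain e where e: "t = expand e" "range e \<subseteq> vec_of_int ` D"
    unfolding self_affine_set_attractor[OF assms] attractor_def by auto
  have "\<exists>d. d \<in> D \<and> e k = vec_of_int d" for k using e(2) by blast
  then obtain d where d: "\<And>k. d k \<in> D" "\<And>k. e k = vec_of_int (d k)" by metis
  have "t = encode d" unfolding encode_def d(2)[symmetric] by (rule e(1))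
  thus "\<exists>d. range d \<subseteq> D \<and> t = encode d" using d(1) by (intro exI[of _ d]) auto
next
  assume "\<exists>d. range d \<subseteq> D \<and> t = encode d"
  then obtain d where d: "range d \<subseteq> D" "t = expand (\<lambda>k. vec_of_int (d k))"
    unfolding encode_def by blast
  show "t \<in> self_affine_set A D"
    unfolding self_affine_set_attractor[OF assms] attractor_def d(2)
    by (rule imageI) (use d(1) in auto)
qed

lemma closed_self_affine_set:
  assumes "finite D" "D \<noteq> {}"
  shows "closed (self_affine_set A D)"
  unfolding self_affine_set_attractor[OF assms]
  using assms by (intro compact_imp_closed attractor_compact finite_imp_compact) simp

text \<open>Following an edge is one step of the contraction. In this form a path is an expansion of
  its end vertex in differences of digits.\<close>
lemma Gamma_edge_iff:
  "(u, (x, y), v) \<in> Gamma_edges A K \<longleftrightarrow> x \<in> K \<and> y \<in> K \<and>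
     vec_of_int v = B (vec_of_int u + (vec_of_int x - vec_of_int y))"
proof -
  have "vec_of_int v = B (vec_of_int u + (vec_of_int x - vec_of_int y)) \<longleftrightarrow>
      vec_of_int (A *v v) = vec_of_int u + (vec_of_int x - vec_of_int y)"
    unfolding vec_of_int_mult[symmetric] by (metis AB BA)
  also have "\<dots> \<longleftrightarrow> vec_of_int (y + A *v v) = vec_of_int (u + x)"
    by (auto simp: vec_of_int_add algebra_simps)
  finally show ?thesis unfolding Gamma_edges_def vec_of_int_inj by auto
qed

lemma walk_expansion:
  assumes "(w, v) \<in> adjacent (Gamma_edges A K) ^^ m"
    and K: "\<And>x y. x \<in> K \<Longrightarrow> y \<in> K \<Longrightarrow> norm (vec_of_int x - vec_of_int y) \<le> E" and "E \<ge> 0"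
  shows "\<exists>e. (\<forall>k. norm (e k) \<le> E) \<and>
    vec_of_int v = (\<Sum>k<m. (B ^^ Suc k) (e k)) + (B ^^ m) (vec_of_int w)"
  using assms(1)
proof (induction m arbitrary: v)
  case 0
  thus ?case using \<open>E \<ge> 0\<close> by (intro exI[of _ "\<lambda>_. 0"]) simp
next
  case (Suc m)
  then obtain u where u: "(w, u) \<in> adjacent (Gamma_edges A K) ^^ m"
    and "(u, v) \<in> adjacent (Gamma_edges A K)" by auto
  then obtain x y where xy: "x \<in> K" "y \<in> K"
    and v: "vec_of_int v = B (vec_of_int u + (vec_of_int x - vec_of_int y))"
    unfolding adjacent_def by (auto simp: Gamma_edge_iff)
  from Suc.IH[OF u] obtain e where e: "\<And>k. norm (e k) \<le> E"
    "vec_of_int u = (\<Sum>k<m. (B ^^ Suc k) (e k)) + (B ^^ m) (vec_of_int w)" by blast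
  let ?e = "case_nat (vec_of_int x - vec_of_int y) e"
  have "norm (?e k) \<le> E" for k using e(1) K[OF xy] by (simp split: nat.split)
  moreover have "vec_of_int v = (\<Sum>k<Suc m. (B ^^ Suc k) (?e k)) + (B ^^ Suc m) (vec_of_int w)"
    unfolding v e(2) by (subst sum.lessThan_Suc_shift)
      (simp add: linear_add[OF lin] linear_sum[OF lin] add_ac)
  ultimately show ?case by blast
qed

lemma walk_bound:
  assumes "(w, v) \<in> adjacent (Gamma_edges A K) ^^ m"
    and "\<And>x y. x \<in> K \<Longrightarrow> y \<in> K \<Longrightarrow> norm (vec_of_int x - vec_of_int y) \<le> E" and "E \<ge> 0"
  shows "norm (vec_of_int v - (B ^^ m) (vec_of_int w)) \<le> M * E / (1 - r)"
proof -
  obtain e where e: "\<And>k. norm (e k) \<le> E"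
    "vec_of_int v = (\<Sum>k<m. (B ^^ Suc k) (e k)) + (B ^^ m) (vec_of_int w)"
    using walk_expansion[OF assms] by blast
  have "norm (\<Sum>k<m. (B ^^ Suc k) (e k)) \<le> (\<Sum>k<m. M * E * r ^ k)"
    by (intro sum_norm_le expand_norm_bounds e(1))
  also have "\<dots> \<le> (\<Sum>k. M * E * r ^ k)"
    using M_nonneg \<open>E \<ge> 0\<close> r by (intro sum_le_suminf geometric_majorant) auto
  also have "\<dots> = M * E / (1 - r)"
    using r by (simp add: suminf_mult suminf_geometric)
  finally show ?thesis by (simp add: e(2))
qed

text \<open>A vertex of the nucleus is reached from a cycle, hence by arbitrarily long walks from one
  fixed vertex. Along a long walk the contribution of the start becomes negligible, so
  \<open>walk_bound\<close> confines the vertex to a fixed ball.\<close>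
lemma finite_nucleus:
  assumes "finite K"
  shows "finite (ND_verts A K)"
proof -
  let ?G = "adjacent (Gamma_edges A K)"
  obtain b where b: "b > 0" "\<And>x. x \<in> K \<Longrightarrow> norm (vec_of_int x) \<le> b"
    using finite_imp_bounded[OF finite_imageI[OF assms, of vec_of_int]]
    unfolding bounded_pos by auto
  have diff_bound: "norm (vec_of_int x - vec_of_int y) \<le> b + b" if "x \<in> K" "y \<in> K" for x y
    using b(2)[OF that(1)] b(2)[OF that(2)] norm_triangle_ineq4[of "vec_of_int x" "vec_of_int y"]
    by linarith
  have "norm (vec_of_int v) \<le> M * (b + b) / (1 - r)" if v: "v \<in> ND_verts A K" for v
  proof -
    obtain w where "(w, w) \<in> ?G\<^sup>+" "(w, v) \<in> ?G\<^sup>*"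
      using v unfolding ND_verts_def nucleus_verts_def by blast
    then obtain n l where n: "n > 0" "(w, w) \<in> ?G ^^ n" and l: "(w, v) \<in> ?G ^^ l"
      by (metis trancl_power rtrancl_power)
    have cyc: "(w, w) \<in> ?G ^^ (n * j)" for j
      using n(2) by (induction j) (auto simp: relpow_add)
    have walk: "(w, v) \<in> ?G ^^ (n * j + l)" for j
      using cyc l by (auto simp: relpow_add)
    have "strict_mono (\<lambda>j. n * j + l)" using n(1) by (auto simp: strict_mono_def)
    moreover have "(\<lambda>m. (B ^^ m) (vec_of_int w)) \<longlonglongrightarrow> 0" by (rule iterate_LIMSEQ_zero) simp
    ultimately have "(\<lambda>j. (B ^^ (n * j + l)) (vec_of_int w)) \<longlonglongrightarrow> 0"
      using LIMSEQ_subseq_LIMSEQ unfolding o_def by blast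
    hence "(\<lambda>j. norm (vec_of_int v - (B ^^ (n * j + l)) (vec_of_int w)))
        \<longlonglongrightarrow> norm (vec_of_int v - 0)"
      by (intro tendsto_intros)
    moreover have "norm (vec_of_int v - (B ^^ (n * j + l)) (vec_of_int w)) \<le> M * (b + b) / (1 - r)" for j
      using b(1) by (intro walk_bound[OF walk diff_bound]) auto
    ultimately show ?thesis by (auto dest: LIMSEQ_le_const2)
  qed
  hence "ND_verts A K \<subseteq> {v. norm (vec_of_int v) \<le> M * (b + b) / (1 - r)}" by blast
  thus ?thesis using finite_bounded_int_vectors by (rule finite_subset)
qed

lemma readable_imp_nucleus:
  assumes "x \<in> left_inf_readable (ND_edges A K C D) v"
  shows "v \<in> ND_verts A K"
  using assms
  unfolding left_inf_readable_def ND_edges_def nucleus_edges_def ND_verts_def by auto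

lemma readable_imp_mem:
  assumes K: "finite K" "C \<subseteq> K" "D \<subseteq> K" and D: "D \<noteq> {}"
    and x: "x \<in> left_inf_readable (ND_edges A K C D) v"
  shows "range x \<subseteq> C" "encode x - vec_of_int v \<in> self_affine_set A D"
proof -
  obtain p where p: "p 0 = v" "\<And>i. (p (Suc i), x i, p i) \<in> ND_edges A K C D"
    using x unfolding left_inf_readable_def by blast
  show xC: "range x \<subseteq> C" using p(2) unfolding ND_edges_def by blast
  have "\<exists>d. d \<in> D \<and> (p (Suc i), (x i, d), p i) \<in> Gamma_edges A K \<and> p i \<in> ND_verts A K" for i
    using p(2)[of i] unfolding ND_edges_def nucleus_edges_def ND_verts_def by blast
  then obtain d where d: "\<And>i. d i \<in> D" "\<And>i. (p (Suc i), (x i, d i), p i) \<in> Gamma_edges A K"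
    "\<And>i. p i \<in> ND_verts A K" by metis
  have xK: "range x \<subseteq> K" and dK: "range d \<subseteq> K" using xC d(1) K by auto
  have "vec_of_int (p 0) = expand (\<lambda>k. vec_of_int (x k) - vec_of_int (d k))"
  proof (rule expand_eqI[where p = "\<lambda>i. vec_of_int (p i)"])
    show "vec_of_int (p i) = B (vec_of_int (p (Suc i)) + (vec_of_int (x i) - vec_of_int (d i)))" for i
      using d(2)[of i] unfolding Gamma_edge_iff by blast
    show "bounded (range (\<lambda>i. vec_of_int (p i)))"
      using d(3) by (intro bounded_int_digits[OF finite_nucleus[OF K(1)]]) auto
    show "bounded (range (\<lambda>k. vec_of_int (x k) - vec_of_int (d k)))"
      by (intro bounded_minus_comp bounded_int_digits[OF K(1)] xK dK)
  qed
  also have "\<dots> = encode x - encode d"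
    by (rule encode_diff[symmetric, OF K(1) xK dK])
  finally have "encode x - vec_of_int v = encode d" using p(1) by simp
  thus "encode x - vec_of_int v \<in> self_affine_set A D"
    using mem_self_affine_set[OF finite_subset[OF K(3,1)] D] d(1) by blast
qed

text \<open>Given \<open>encode x - v = encode d\<close>, the edge relation forces the predecessor of each vertex.
  The \<open>i\<close>-th vertex is the difference of the expansions of \<open>x\<close> and \<open>d\<close> shifted by \<open>i\<close>, so the path
  stays in a bounded, hence finite, set of integer vectors. Some vertex recurs arbitrarily far back,
  which puts a cycle before every vertex of the path.\<close>
lemma mem_imp_readable:
  assumes K: "finite K" "C \<subseteq> K" "D \<subseteq> K" and D: "D \<noteq> {}"
    and x: "range x \<subseteq> C" and T: "encode x - vec_of_int v \<in> self_affine_set A D"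
  shows "x \<in> left_inf_readable (ND_edges A K C D) v"
proof -
  let ?G = "adjacent (Gamma_edges A K)"
  obtain d where d: "range d \<subseteq> D" "encode x - vec_of_int v = encode d"
    using T mem_self_affine_set[OF finite_subset[OF K(3,1)] D] by blast
  have xK: "range x \<subseteq> K" and dK: "range d \<subseteq> K" using x d(1) K by auto
  define p where "p = rec_nat v (\<lambda>i q. A *v q + d i - x i)"
  have p0: "p 0 = v" and pS: "p (Suc i) = A *v p i + d i - x i" for i
    by (simp_all add: p_def)
  have edge: "(p (Suc i), (x i, d i), p i) \<in> Gamma_edges A K" for i
    using xK dK by (auto simp: Gamma_edges_def pS)
  have p_eq: "vec_of_int (p i) = encode (\<lambda>k. x (k + i)) - encode (\<lambda>k. d (k + i))" for i
  proof (induction i)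
    case 0
    show ?case using d(2) by (simp add: p0 algebra_simps)
  next
    case (Suc i)
    have shift: "map_matrix real_of_int A *v encode (\<lambda>k. z (k + i)) =
        vec_of_int (z i) + encode (\<lambda>k. z (k + Suc i))" if "range z \<subseteq> K" for z
    proof -
      have "range (\<lambda>k. z (k + i)) \<subseteq> K" using that by auto
      from encode_shift[OF K(1) this] show ?thesis by (simp add: AB)
    qed
    have "vec_of_int (p (Suc i)) = map_matrix real_of_int A *v vec_of_int (p i) +
        vec_of_int (d i) - vec_of_int (x i)"
      by (simp add: pS vec_of_int_add vec_of_int_diff vec_of_int_mult)
    also have "\<dots> = encode (\<lambda>k. x (k + Suc i)) - encode (\<lambda>k. d (k + Suc i))"
      unfolding Suc.IH matrix_vector_mult_diff_distrib shift[OF xK] shift[OF dK] by simp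
    finally show ?case .
  qed
  obtain b where b: "\<And>x. x \<in> K \<Longrightarrow> norm (vec_of_int x) \<le> b"
    using finite_imp_bounded[OF finite_imageI[OF K(1), of vec_of_int]]
    unfolding bounded_iff by auto
  have enc_bound: "norm (encode (\<lambda>k. z (k + i))) \<le> M * b / (1 - r)" if "range z \<subseteq> K" for z i
    unfolding encode_def using that by (intro expand_le b) auto
  have "range p \<subseteq> {v. norm (vec_of_int v) \<le> M * b / (1 - r) + M * b / (1 - r)}"
  proof clarify
    fix i
    show "norm (vec_of_int (p i)) \<le> M * b / (1 - r) + M * b / (1 - r)"
      unfolding p_eq
      by (rule order_trans[OF norm_triangle_ineq4 add_mono[OF enc_bound[OF xK] enc_bound[OF dK]]])
  qed
  hence fin: "finite (range p)" using finite_bounded_int_vectors by (rule finite_subset)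
  have walk: "(p (i + k), p i) \<in> ?G ^^ k" for i k
  proof (induction k)
    case (Suc k)
    have "(p (i + Suc k), p (i + k)) \<in> ?G" using edge[of "i + k"] by (auto simp: adjacent_def)
    thus ?case by (rule relpow_Suc_I2[OF _ Suc.IH])
  qed simp
  have nucleus: "p i \<in> nucleus_verts (Gamma_edges A K)" for i
  proof -
    have "finite (range (\<lambda>k. p (i + k)))" by (rule finite_subset[OF _ fin]) auto
    hence "\<not> inj (\<lambda>k. p (i + k))" using finite_imageD infinite_UNIV_nat by blast
    then obtain a c where "p (i + a) = p (i + c)" "a < c"
      unfolding inj_def by (metis nat_neq_iff)
    hence "(p (i + a), p (i + a)) \<in> ?G ^^ (c - a)"
      using walk[of "i + a" "c - a"] by simp
    hence "(p (i + a), p (i + a)) \<in> ?G\<^sup>+"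
      using \<open>a < c\<close> by (auto simp: trancl_power intro!: exI[of _ "c - a"])
    moreover have "(p (i + a), p i) \<in> ?G\<^sup>*"
      using walk by (rule relpow_imp_rtrancl)
    ultimately show ?thesis unfolding nucleus_verts_def by blast
  qed
  have "(p (Suc i), x i, p i) \<in> ND_edges A K C D" for i
  proof -
    have "(p (Suc i), (x i, d i), p i) \<in> nucleus_edges (Gamma_edges A K)"
      using edge nucleus unfolding nucleus_edges_def by blast
    thus ?thesis using x d(1) unfolding ND_edges_def by blast
  qed
  thus ?thesis unfolding left_inf_readable_def using p0 by blast
qed

end

context digit_transversal
begin

text \<open>The pairs \<open>(v, v + u)\<close> with \<open>v\<close> outside the nucleus, or \<open>v + u\<close> outside it, contribute
  nothing, which reduces the lattice sum to the finite sum over pairs of vertices.\<close>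
lemma emeasure_translates_inter:
  assumes K: "finite K" "C \<subseteq> K" "D \<subseteq> K" and D: "D \<noteq> {}"
  defines "T \<equiv> self_affine_set A D" and "V \<equiv> ND_verts A K"
    and "F \<equiv> left_inf_readable (ND_edges A K C D)"
  shows "emeasure lebesgue (T \<inter> (\<lambda>t. t + vec_of_int u) ` T) =
    (\<Sum>(v1, v2) \<in> {(v1, v2). v1 \<in> V \<and> v2 \<in> V \<and> u = v2 - v1}. emeasure \<beta> (F v1 \<inter> F v2))"
proof -
  let ?TT = "T \<inter> (\<lambda>t. t + vec_of_int u) ` T"
  define W where "W = {v \<in> V. v + u \<in> V}"
  have T: "closed T" unfolding T_def by (rule closed_self_affine_set[OF finite_subset[OF K(3,1)] D])
  have TT: "?TT = {y. y \<in> T \<and> y - vec_of_int u \<in> T}"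
    by (auto simp: image_iff) (metis diff_add_cancel)
  have "closed ?TT"
    using T closed_translation[OF T, of "vec_of_int u"] by (intro closed_Int) (auto simp: add.commute)
  hence TT_borel: "?TT \<in> sets borel" by (rule borel_closed)
  have F: "F v = {x. range x \<subseteq> C \<and> encode x - vec_of_int v \<in> T}" for v
    unfolding F_def T_def
    using readable_imp_mem[OF K D] mem_imp_readable[OF K D] by blast
  have F_inter: "{x \<in> space \<beta>. encode x - vec_of_int v \<in> ?TT} = F v \<inter> F (v + u)" for v
    unfolding TT F space_bernoulli by (auto simp: vec_of_int_add diff_diff_eq)
  have F_empty: "F v = {}" if "v \<notin> V" for v
    using readable_imp_nucleus that unfolding F_def V_def by blast
  have "finite V" unfolding V_def by (rule finite_nucleus[OF K(1)])
  hence "finite W" unfolding W_def by simp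
  have "emeasure lebesgue ?TT = emeasure lattice_sum ?TT"
    using TT_borel by (simp add: lattice_sum_eq_lborel)
  also have "\<dots> = (\<integral>\<^sup>+v. emeasure \<beta> (F v \<inter> F (v + u)) \<partial>count_space UNIV)"
    by (simp only: emeasure_lattice_sum[OF TT_borel] F_inter)
  also have "\<dots> = (\<Sum>v\<in>W. emeasure \<beta> (F v \<inter> F (v + u)))"
    by (rule nn_integral_count_space'[OF \<open>finite W\<close>]) (auto simp: W_def F_empty)
  also have "\<dots> = (\<Sum>(v1, v2) \<in> {(v1, v2). v1 \<in> V \<and> v2 \<in> V \<and> u = v2 - v1}. emeasure \<beta> (F v1 \<inter> F v2))"
    by (rule sum.reindex_bij_witness[where j = "\<lambda>v. (v, v + u)" and i = fst])
       (auto simp: W_def)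
  finally show ?thesis .
qed

end

section \<open>Measures of intersections with integer translates\<close>
theorem mainTheorem2:
  fixes A :: "int ^ 'n ^ 'n"
    and D K C :: "(int ^ 'n) set"
    and u :: "int ^ 'n"
  defines "T \<equiv> self_affine_set A D"
    and "V \<equiv> ND_verts A K"
    and "F \<equiv> left_inf_readable (ND_edges A K C D)"
    and "\<mu> \<equiv> bernoulli_measure C"
  assumes "expanding A"
    and "finite D" and "D \<noteq> {}"
    and "if contains_coset_reps A D then K = D
         else finite K \<and> D \<subseteq> K \<and> contains_coset_reps A K"
    and "C \<subseteq> K" and "coset_transversal A C"
  shows "emeasure lebesgue (T \<inter> (\<lambda>t. t + vec_of_int u) ` T) =
    (\<Sum>(v1, v2) \<in> {(v1, v2). v1 \<in> V \<and> v2 \<in> V \<and> u = v2 - v1}. emeasure \<mu> (F v1 \<inter> F v2))"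
proof -
  have K: "finite K" "D \<subseteq> K" using assms(6,8) by (auto split: if_splits)
  obtain B :: "real ^ 'n \<Rightarrow> real ^ 'n" and M r where B: "linear B"
    "\<And>x. map_matrix real_of_int A *v B x = x" "\<And>x. B (map_matrix real_of_int A *v x) = x"
    "0 < r" "r < 1" "\<And>k x. norm ((B ^^ k) x) \<le> M * r ^ k * norm x"
    by (rule expanding_inverse_decays[OF \<open>expanding A\<close>]) blast
  interpret digit_transversal B M r A C
    by (intro digit_transversal.intro expanding_matrix.intro iterated_contraction.intro
        expanding_matrix_axioms.intro digit_transversal_axioms.intro B
        \<open>coset_transversal A C\<close> finite_subset[OF \<open>C \<subseteq> K\<close> K(1)])
  show ?thesis
    unfolding T_def V_def F_def \<mu>_def
    by (rule emeasure_translates_inter[OF K(1) \<open>C \<subseteq> K\<close> K(2) \<open>D \<noteq> {}\<close>])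
qed

end
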